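(* Let $(S,T)$ be a closed triangulated connected surface with set of edges $E$ and set of vertices $V$, and let $I\in\mathbb{R}_{\ge 0}^E$, considered as the inversive distance. (1) A hyperbolic inversive distance circle packing metric on $(S,T)$ of inversive distance $I$ is determined by its discrete curvature $k:V\to\mathbb{R}$; that is, if two hyperbolic inversive distance circle packing metrics on $(S,T)$ with the same inversive distance $I$, with edge length functions $l$ and $l'$, have the same discrete curvature $k$, then $l=l'$. (2) A Euclidean inversive distance circle packing metric on $(S,T)$ of inversive distance $I$ is determined by its discrete curvature $k:V\to\mathbb{R}$ up to scaling; that is, if two Euclidean inversive distance circle packing metrics on $(S,T)$ with the same inversive distance $I$, with edge length functions $l$ and $l'$, have the same discrete curvature $k$, then $l'=\lambda l$ for some $\lambda>0$.
   Context: Fix $I\in\mathbb{R}_{\ge0}^E$. For a radius vector $r\in\mathbb{R}_{>0}^V$, define an edge length function $l:E\to\mathbb{R}_{>0}$ as follows, where $u,v$ denote the end points of the edge $e$. Euclidean case: $l(e)=\sqrt{r(v)^2+r(u)^2+2r(v)r(u)I(e)}$. Hyperbolic case: $l(e)=\cosh^{-1}\big(\cosh(r(v))\cosh(r(u))+I(e)\sinh(r(v))\sinh(r(u))\big)$. If $l(e_i)+l(e_j)>l(e_k)$ (for all permutations) for the three edges $e_i,e_j,e_k$ of each triangle of $T$, then $l$ defines a Euclidean (resp. hyperbolic) polyhedral metric on $(S,T)$, in which each triangle of $T$ is isometric to the Euclidean (resp. hyperbolic, curvature $-1$) geodesic triangle with the given edge lengths. This polyhedral metric is called the Euclidean (resp.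 hyperbolic) inversive distance circle packing metric with inversive distance $I$ (and radius vector $r$). The discrete curvature $k:V\to\mathbb{R}$ of a polyhedral metric is $k(v)=2\pi-\sum_{i=1}^m\theta_i$, where $\theta_1,\dots,\theta_m$ are the inner angles at the vertex $v$ of the triangles of $T$ at $v$. *)

theory Defs
  imports "HOL-Analysis.Analysis"
begin

section \<open>Closed triangulated surfaces\<close>

text \<open>
  A closed triangulated surface is a finite disjoint union of triangles whose sides are identified
  in pairs by homeomorphisms.  The corners of a triangle \<open>t\<close> are the pairs \<open>(t, j)\<close> with \<open>j :: 3\<close>,
  and the pair \<open>(t, i)\<close> also names the side of \<open>t\<close> opposite to the corner \<open>(t, i)\<close>; arithmetic on
  the indices is modulo 3.  The side \<open>(t, i)\<close> is glued to a side of the triangle \<open>nbr T t i\<close>; the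
  permutation \<open>glue T t i\<close> of the labels sends each end point \<open>j\<close> (\<open>j \<noteq> i\<close>) of the side to the end
  point it is glued to, and \<open>i\<close> to the label of the side it is glued to.

  Non-orientable surfaces are included, and the triangulation need not be a simplicial complex:
  an edge may be a loop, two edges may share both end points, and two sides of one triangle may be
  glued together.  Triangulations by simplicial complexes are a special case.
\<close>

record 'f gluing =
  triangles :: "'f set"
  nbr :: "'f \<Rightarrow> 3 \<Rightarrow> 'f"
  glue :: "'f \<Rightarrow> 3 \<Rightarrow> 3 \<Rightarrow> 3"

text \<open>Every side is glued, so the surface has no boundary; the last condition says that no side is
  glued to itself.\<close>

definition closed_triangulated_surface :: "'f gluing \<Rightarrow> bool" where
  "closed_triangulated_surface T \<longleftrightarrow>
     finite (triangles T) \<and> triangles T \<noteq> {} \<and>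
     (\<forall>t \<in> triangles T. \<forall>i.
        nbr T t i \<in> triangles T \<and> bij (glue T t i) \<and>
        nbr T (nbr T t i) (glue T t i i) = t \<and>
        glue T (nbr T t i) (glue T t i i) = inv (glue T t i) \<and>
        (nbr T t i, glue T t i i) \<noteq> (t, i))"

definition connected_surface :: "'f gluing \<Rightarrow> bool" where
  "connected_surface T \<longleftrightarrow>
     (\<forall>s \<in> triangles T. \<forall>t \<in> triangles T. (s, t) \<in> {(t, nbr T t i) | t i. t \<in> triangles T}\<^sup>*)"

text \<open>Edges are classes of sides, vertices are classes of corners.\<close>

definition edge :: "'f gluing \<Rightarrow> 'f \<times> 3 \<Rightarrow> ('f \<times> 3) set" where
  "edge T = (\<lambda>(t, i). {(t, i), (nbr T t i, glue T t i i)})"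

definition edges :: "'f gluing \<Rightarrow> ('f \<times> 3) set set" where
  "edges T = edge T ` (triangles T \<times> UNIV)"

definition corner_rel :: "'f gluing \<Rightarrow> (('f \<times> 3) \<times> ('f \<times> 3)) set" where
  "corner_rel T = {((t, j), (nbr T t i, glue T t i j)) | t i j. t \<in> triangles T \<and> j \<noteq> i}\<^sup>*"

definition vertex :: "'f gluing \<Rightarrow> 'f \<times> 3 \<Rightarrow> ('f \<times> 3) set" where
  "vertex T c = corner_rel T `` {c}"

definition vertices :: "'f gluing \<Rightarrow> ('f \<times> 3) set set" where
  "vertices T = (triangles T \<times> UNIV) // corner_rel T"


section \<open>Inner angles of geodesic triangles\<close>

definition eucl_angle :: "real^2 \<Rightarrow> real^2 \<Rightarrow> real^2 \<Rightarrow> real" where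
  "eucl_angle A B C = arccos (((B - A) \<bullet> (C - A)) / (norm (B - A) * norm (C - A)))"

text \<open>The inner angle opposite to the side of length \<open>a\<close>.\<close>

definition eucl_inner_angle :: "real \<Rightarrow> real \<Rightarrow> real \<Rightarrow> real" where
  "eucl_inner_angle a b c =
     (THE \<theta>. \<exists>A B C. dist B C = a \<and> dist C A = b \<and> dist A B = c \<and> \<theta> = eucl_angle A B C)"

text \<open>The hyperbolic plane of curvature \<open>-1\<close> is the upper sheet of the hyperboloid in Minkowski
  space.  The geodesic from \<open>A\<close> to \<open>B\<close> leaves \<open>A\<close> in the direction of the projection
  \<open>hyp_dir A B\<close> of \<open>B\<close> to the tangent plane at \<open>A\<close>, on which the Minkowski form is positive
  definite.\<close>

definition mink :: "real \<times> (real^2) \<Rightarrow> real \<times> (real^2) \<Rightarrow> real" where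
  "mink A B = snd A \<bullet> snd B - fst A * fst B"

definition hyp_plane :: "(real \<times> (real^2)) set" where
  "hyp_plane = {A. mink A A = - 1 \<and> 0 < fst A}"

definition hyp_dist :: "real \<times> (real^2) \<Rightarrow> real \<times> (real^2) \<Rightarrow> real" where
  "hyp_dist A B = arcosh (- mink A B)"

definition hyp_dir :: "real \<times> (real^2) \<Rightarrow> real \<times> (real^2) \<Rightarrow> real \<times> (real^2)" where
  "hyp_dir A B = B + mink A B *\<^sub>R A"

definition hyp_angle :: "real \<times> (real^2) \<Rightarrow> real \<times> (real^2) \<Rightarrow> real \<times> (real^2) \<Rightarrow> real" where
  "hyp_angle A B C =
     arccos (mink (hyp_dir A B) (hyp_dir A C) /
       (sqrt (mink (hyp_dir A B) (hyp_dir A B)) * sqrt (mink (hyp_dir A C) (hyp_dir A C))))"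

definition hyp_inner_angle :: "real \<Rightarrow> real \<Rightarrow> real \<Rightarrow> real" where
  "hyp_inner_angle a b c =
     (THE \<theta>. \<exists>A \<in> hyp_plane. \<exists>B \<in> hyp_plane. \<exists>C \<in> hyp_plane.
        hyp_dist B C = a \<and> hyp_dist C A = b \<and> hyp_dist A B = c \<and> \<theta> = hyp_angle A B C)"

text \<open>The inner angles are well defined and satisfy the cosine laws.\<close>

lemma eucl_inner_angle_eq:
  assumes "a < b + c" "b < c + a" "c < a + b"
  shows "eucl_inner_angle a b c = arccos ((b\<^sup>2 + c\<^sup>2 - a\<^sup>2) / (2 * b * c))"
proof -
  have pos: "a > 0" "b > 0" "c > 0" using assms by auto
  define x where "x = (b\<^sup>2 + c\<^sup>2 - a\<^sup>2) / (2 * b * c)"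
  have cosine: "eucl_angle A B C = arccos x"
    if "dist B C = a" "dist C A = b" "dist A B = c" for A B C
  proof -
    have n: "norm (B - A) = c" "norm (C - A) = b" using that by (auto simp: dist_norm norm_minus_commute)
    have "a\<^sup>2 = (norm ((B - A) - (C - A)))\<^sup>2" using that by (simp add: dist_norm)
    also have "\<dots> = c\<^sup>2 + b\<^sup>2 - 2 * ((B - A) \<bullet> (C - A))"
      using n by (simp add: dot_norm_neg field_simps)
    finally have e: "(B - A) \<bullet> (C - A) = (b\<^sup>2 + c\<^sup>2 - a\<^sup>2) / 2" by simp
    show ?thesis unfolding eucl_angle_def x_def n e by (simp add: mult_ac)
  qed
  have "b\<^sup>2 + c\<^sup>2 - a\<^sup>2 \<le> 2 * b * c"
    using abs_le_square_iff[of "b - c" a] assms by (simp add: power2_diff abs_le_iff)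
  moreover have "- (2 * b * c) \<le> b\<^sup>2 + c\<^sup>2 - a\<^sup>2"
    using abs_le_square_iff[of a "b + c"] assms pos by (simp add: power2_sum)
  ultimately have x: "x \<le> 1" "- 1 \<le> x" using pos by (auto simp: x_def field_simps)
  define y where "y = sqrt (1 - x\<^sup>2)"
  have y: "y\<^sup>2 = 1 - x\<^sup>2" using x by (simp add: y_def abs_square_le_1 abs_le_iff)
  have bx: "2 * b * c * x = b\<^sup>2 + c\<^sup>2 - a\<^sup>2" using pos by (simp add: x_def)
  define A :: "real^2" where "A = 0"
  define B :: "real^2" where "B = vector [c, 0]"
  define C :: "real^2" where "C = vector [b * x, b * y]"
  have "(c - b * x)\<^sup>2 + (b * y)\<^sup>2 = a\<^sup>2"
    using bx by (simp add: power2_diff power_mult_distrib y algebra_simps)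
  moreover have "(b * x)\<^sup>2 + (b * y)\<^sup>2 = b\<^sup>2" by (simp add: power_mult_distrib y algebra_simps)
  ultimately have "dist B C = a" "dist C A = b" "dist A B = c"
    using pos by (auto simp: A_def B_def C_def dist_norm norm_vec_def L2_set_def sum_2)
  then show ?thesis
    unfolding eucl_inner_angle_def x_def[symmetric]
    by (intro the_equality) (use cosine in metis)+
qed

lemma hyp_inner_angle_eq:
  assumes "a < b + c" "b < c + a" "c < a + b"
  shows "hyp_inner_angle a b c = arccos ((cosh b * cosh c - cosh a) / (sinh b * sinh c))"
proof -
  have pos: "a > 0" "b > 0" "c > 0" using assms by auto
  then have sh: "sinh b > 0" "sinh c > 0" by auto
  define x where "x = (cosh b * cosh c - cosh a) / (sinh b * sinh c)"
  have ge1: "1 \<le> - mink A B" if "A \<in> hyp_plane" "B \<in> hyp_plane" for A B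
  proof -
    have A: "(norm (snd A))\<^sup>2 = (fst A)\<^sup>2 - 1" "fst A > 0"
      and B: "(norm (snd B))\<^sup>2 = (fst B)\<^sup>2 - 1" "fst B > 0"
      using that by (auto simp: hyp_plane_def mink_def power2_norm_eq_inner power2_eq_square[of "fst _"])
    have le: "snd A \<bullet> snd B \<le> norm (snd A) * norm (snd B)" by (rule norm_cauchy_schwarz)
    have "0 \<le> (norm (snd A))\<^sup>2" "0 \<le> (norm (snd B))\<^sup>2" by simp_all
    then have "1 \<le> fst A" "1 \<le> fst B"
      using A B abs_le_square_iff[of 1 "fst A"] abs_le_square_iff[of 1 "fst B"] by auto
    then have "1 * 1 \<le> fst A * fst B" by (intro mult_mono) auto
    moreover have "(norm (snd A) * norm (snd B))\<^sup>2 \<le> (fst A * fst B - 1)\<^sup>2"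
    proof -
      have "0 \<le> (fst A - fst B)\<^sup>2" by simp
      then show ?thesis unfolding power_mult_distrib A B by (simp add: power2_eq_square algebra_simps)
    qed
    ultimately have "norm (snd A) * norm (snd B) \<le> fst A * fst B - 1"
      using power2_le_imp_le by force
    then show ?thesis using le by (simp add: mink_def)
  qed
  have comm: "mink A B = mink B A" for A B by (simp add: mink_def inner_commute mult.commute)
  have dir: "mink (hyp_dir A B) (hyp_dir A C) = mink B C + mink A B * mink A C"
    if "A \<in> hyp_plane" for A B C
  proof -
    have "mink (hyp_dir A B) (hyp_dir A C)
        = mink B C + 2 * (mink A B * mink A C) + mink A B * mink A C * mink A A"
      by (simp add: mink_def hyp_dir_def inner_add_left inner_add_right inner_commute algebra_simps)
    then show ?thesis using that by (simp add: hyp_plane_def)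
  qed
  have cosine: "hyp_angle A B C = arccos x"
    if h: "A \<in> hyp_plane" "B \<in> hyp_plane" "C \<in> hyp_plane"
      and "hyp_dist B C = a" "hyp_dist C A = b" "hyp_dist A B = c" for A B C
  proof -
    have m: "mink B C = - cosh a" "mink A C = - cosh b" "mink A B = - cosh c"
      using that ge1[of B C] ge1[of C A] ge1[of A B] comm[of A C]
      by (auto simp: hyp_dist_def cosh_arcosh_real)
    have BB: "mink B B = - 1" "mink C C = - 1" using h by (auto simp: hyp_plane_def)
    have "sqrt ((cosh c)\<^sup>2 - 1) = sinh c" "sqrt ((cosh b)\<^sup>2 - 1) = sinh b"
      using sh by (auto simp: cosh_square_eq)
    then show ?thesis unfolding hyp_angle_def x_def dir[OF h(1)] m BB
      by (simp add: power2_eq_square algebra_simps)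
  qed
  have "cosh (b - c) \<le> cosh a"
    using cosh_real_nonneg_le_iff[of "\<bar>b - c\<bar>" a] assms pos by (simp add: abs_le_iff)
  moreover have "cosh a \<le> cosh (b + c)"
    using cosh_real_nonneg_le_iff[of a "b + c"] assms pos by simp
  ultimately have x: "x \<le> 1" "- 1 \<le> x"
    using sh by (auto simp: x_def field_simps cosh_add cosh_diff)
  define y where "y = sqrt (1 - x\<^sup>2)"
  have y: "y\<^sup>2 = 1 - x\<^sup>2" using x by (simp add: y_def abs_square_le_1 abs_le_iff)
  have bx: "sinh b * sinh c * x = cosh b * cosh c - cosh a" using sh by (simp add: x_def)
  define A :: "real \<times> (real^2)" where "A = (1, 0)"
  define B :: "real \<times> (real^2)" where "B = (cosh c, vector [sinh c, 0])"
  define C :: "real \<times> (real^2)" where "C = (cosh b, vector [sinh b * x, sinh b * y])"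
  have "sinh b * x * (sinh b * x) + sinh b * y * (sinh b * y) = (sinh b)\<^sup>2 * (x\<^sup>2 + y\<^sup>2)"
    by (simp add: power2_eq_square algebra_simps)
  then have "sinh b * x * (sinh b * x) + sinh b * y * (sinh b * y) = cosh b * cosh b - 1"
    using cosh_square_eq[of b] by (simp add: y power2_eq_square[of "cosh b"])
  moreover have "sinh c * sinh c = cosh c * cosh c - 1"
    using sinh_square_eq[of c] by (simp add: power2_eq_square)
  ultimately have mem: "A \<in> hyp_plane" "B \<in> hyp_plane" "C \<in> hyp_plane"
    by (auto simp: A_def B_def C_def hyp_plane_def mink_def inner_vec_def sum_2)
  have "- mink B C = cosh a" "- mink C A = cosh b" "- mink A B = cosh c"
    using bx by (auto simp: A_def B_def C_def mink_def inner_vec_def sum_2 algebra_simps)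
  then have "hyp_dist B C = a" "hyp_dist C A = b" "hyp_dist A B = c"
    using pos by (auto simp: hyp_dist_def arcosh_cosh_real)
  then show ?thesis
    unfolding hyp_inner_angle_def x_def[symmetric]
    by (intro the_equality) (use mem cosine in metis)+
qed


section \<open>Inversive distance circle packing metrics\<close>

text \<open>Polyhedral metrics on a triangulated surface are identified with their edge length functions;
  functions on the edges and vertices are only relevant on \<open>edges T\<close> and \<open>vertices T\<close>.\<close>

definition polyhedral_metric :: "'f gluing \<Rightarrow> (('f \<times> 3) set \<Rightarrow> real) \<Rightarrow> bool" where
  "polyhedral_metric T l \<longleftrightarrow>
     (\<forall>e \<in> edges T. 0 < l e) \<and>
     (\<forall>t \<in> triangles T. \<forall>i.
        l (edge T (t, i)) < l (edge T (t, i + 1)) + l (edge T (t, i + 2)))"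

definition eucl_length :: "real \<Rightarrow> real \<Rightarrow> real \<Rightarrow> real" where
  "eucl_length \<eta> x y = sqrt (x\<^sup>2 + y\<^sup>2 + 2 * x * y * \<eta>)"

definition hyp_length :: "real \<Rightarrow> real \<Rightarrow> real \<Rightarrow> real" where
  "hyp_length \<eta> x y = arcosh (cosh x * cosh y + \<eta> * sinh x * sinh y)"

text \<open>The end points of the edge of the side \<open>(t, i)\<close> are the vertices of the corners \<open>(t, i + 1)\<close>
  and \<open>(t, i + 2)\<close>.\<close>

definition eucl_inversive_metric ::
  "'f gluing \<Rightarrow> (('f \<times> 3) set \<Rightarrow> real) \<Rightarrow> (('f \<times> 3) set \<Rightarrow> real) \<Rightarrow> bool" where
  "eucl_inversive_metric T I l \<longleftrightarrow> polyhedral_metric T l \<and>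
     (\<exists>r. (\<forall>v \<in> vertices T. 0 < r v) \<and>
        (\<forall>t \<in> triangles T. \<forall>i.
           l (edge T (t, i)) =
             eucl_length (I (edge T (t, i))) (r (vertex T (t, i + 1))) (r (vertex T (t, i + 2)))))"

definition hyp_inversive_metric ::
  "'f gluing \<Rightarrow> (('f \<times> 3) set \<Rightarrow> real) \<Rightarrow> (('f \<times> 3) set \<Rightarrow> real) \<Rightarrow> bool" where
  "hyp_inversive_metric T I l \<longleftrightarrow> polyhedral_metric T l \<and>
     (\<exists>r. (\<forall>v \<in> vertices T. 0 < r v) \<and>
        (\<forall>t \<in> triangles T. \<forall>i.
           l (edge T (t, i)) =
             hyp_length (I (edge T (t, i))) (r (vertex T (t, i + 1))) (r (vertex T (t, i + 2)))))"

text \<open>A vertex is the set of the corners at it, so the sums run over all inner angles at \<open>v\<close>.\<close>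

definition eucl_curvature ::
  "'f gluing \<Rightarrow> (('f \<times> 3) set \<Rightarrow> real) \<Rightarrow> ('f \<times> 3) set \<Rightarrow> real" where
  "eucl_curvature T l v = 2 * pi -
     (\<Sum>(t, j) \<in> v.
        eucl_inner_angle (l (edge T (t, j))) (l (edge T (t, j + 1))) (l (edge T (t, j + 2))))"

definition hyp_curvature ::
  "'f gluing \<Rightarrow> (('f \<times> 3) set \<Rightarrow> real) \<Rightarrow> ('f \<times> 3) set \<Rightarrow> real" where
  "hyp_curvature T l v = 2 * pi -
     (\<Sum>(t, j) \<in> v.
        hyp_inner_angle (l (edge T (t, j))) (l (edge T (t, j + 1))) (l (edge T (t, j + 2))))"

end

theory Submission imports Defs begin

text \<open>
  The proof is variational.  Give a circle of radius \<open>r\<close> the coordinate \<open>u = ln (r / 2)\<close> in the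
  Euclidean and \<open>u = ln (tanh (r / 2))\<close> in the hyperbolic case.  For one triangle with fixed
  inversive distances, the Jacobian of the three angles with respect to the three coordinates is
  symmetric and negative definite (in the Euclidean case: negative semidefinite, and its kernel is
  spanned by \<open>(1, 1, 1)\<close>).  If the set of coordinates that satisfy the triangle inequalities
  were convex, integration along a segment would give for any two packings \<open>u\<close>, \<open>u'\<close> of a triangle
  \[ \sum_i (\theta_i(u') - \theta_i(u)) (u'_i - u_i) \le 0, \]
  with equality only if \<open>u' - u\<close> is in the kernel.  For inversive distances above \<open>1\<close> that set need
  not be convex.  As observed by Luo, the angles extend continuously across the degenerate triples
  of lengths by the constants \<open>0\<close> and \<open>\<pi>\<close>.  Along a segment the weighted sum of the extended
  angles is continuous, does not increase where the triangle is nondegenerate, and takes finitely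
  many values elsewhere; so it does not increase at all (\<open>nonincreasing_off_finite_set\<close>), which
  gives the inequality (\<open>triangle_angles_monotone\<close>).

  Now add up the inequality over all triangles of the surface.  Collecting the corners at each vertex
  gives the sum over the vertices of \<open>u' - u\<close> times the difference of the angle sums, which vanishes
  if the curvatures agree.  So equality holds in each triangle (\<open>rigid_on_triangles\<close>).
  In the hyperbolic case \<open>u' = u\<close>; in the Euclidean case \<open>u' - u\<close> is constant on each triangle,
  hence on the connected surface, and the metrics differ by a scaling.

  Both geometries are treated at once by a parameter \<open>\<kappa>\<close>, equal to \<open>0\<close> for the Euclidean and to
  \<open>1\<close> for the hyperbolic plane.  A length \<open>l\<close> enters through \<open>q = l\<^sup>2 / 2\<close> or \<open>q = cosh l - 1\<close>, in
  which all identities below are polynomial.  The sign of the Jacobian is due to Guo; the argument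
  here avoids his deformation in the radii.  The Jacobian is a product of the matrix \<open>- N\<close> of the
  derivatives of angles by lengths with the matrix \<open>M\<close> of the derivatives of lengths by coordinates.
  Since the inversive distances are nonnegative, \<open>M\<close> has zero diagonal and positive other entries, so
  \<open>det M > 0\<close>, and Sylvester's criterion can be checked explicitly (\<open>angle_form_neg_aux\<close>).
\<close>

section \<open>Angles as functions of the lengths\<close>

text \<open>For \<open>q = l\<^sup>2 / 2\<close> and \<open>\<kappa> = 0\<close> this is \<open>l\<^sup>2\<close>, for \<open>q = cosh l - 1\<close> and \<open>\<kappa> = 1\<close> it is \<open>(sinh l)\<^sup>2\<close>.\<close>

definition geo_sq :: "real \<Rightarrow> real \<Rightarrow> real" where
  "geo_sq \<kappa> q = q * (2 + \<kappa> * q)"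

text \<open>The numerator in the cosine law for the angle opposite to the side \<open>x\<close>.\<close>

definition cos_num :: "real \<Rightarrow> real \<Rightarrow> real \<Rightarrow> real \<Rightarrow> real" where
  "cos_num \<kappa> x y z = y + z - x + \<kappa> * y * z"

text \<open>By \<open>gram_eq\<close> below this is \<open>geo_sq \<kappa> y * geo_sq \<kappa> z\<close> times the squared sine of the angle opposite to
  \<open>x\<close>; it is symmetric in the sides, and positive if and only if the triangle is nondegenerate.\<close>

definition gram :: "real \<Rightarrow> real \<Rightarrow> real \<Rightarrow> real \<Rightarrow> real" where
  "gram \<kappa> x y z = 2 * (x * y + y * z + z * x) - (x\<^sup>2 + y\<^sup>2 + z\<^sup>2) + 2 * \<kappa> * x * y * z"

text \<open>Clamping the cosine extends the angle continuously to all triples of positive lengths.\<close>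

definition ext_angle :: "real \<Rightarrow> real \<Rightarrow> real \<Rightarrow> real \<Rightarrow> real" where
  "ext_angle \<kappa> x y z =
     arccos (max (- 1) (min 1 (cos_num \<kappa> x y z / sqrt (geo_sq \<kappa> y * geo_sq \<kappa> z))))"

lemma gram_eq: "geo_sq \<kappa> y * geo_sq \<kappa> z - (cos_num \<kappa> x y z)\<^sup>2 = gram \<kappa> x y z"
  unfolding geo_sq_def cos_num_def gram_def by (simp add: power2_eq_square algebra_simps)

lemma gram_rotate: "gram \<kappa> y z x = gram \<kappa> x y z"
  by (simp add: gram_def algebra_simps)

section \<open>Definiteness of the Jacobian of the angles\<close>

text \<open>The allowance for a vanishing determinant serves the Euclidean case, where \<open>(1, 1, 1)\<close> is in the
  kernel and can be used to make \<open>z = 0\<close>.\<close>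

lemma sylvester3:
  fixes p q r f g h x y z :: real
  defines "m \<equiv> p * q - f\<^sup>2"
    and "D \<equiv> p * q * r + 2 * f * g * h - p * h\<^sup>2 - q * g\<^sup>2 - r * f\<^sup>2"
    and "Q \<equiv> p * x\<^sup>2 + q * y\<^sup>2 + r * z\<^sup>2 + 2 * f * x * y + 2 * g * x * z + 2 * h * y * z"
  assumes "0 < p" "0 < m" "0 \<le> D"
  shows "0 \<le> Q" and "Q = 0 \<Longrightarrow> 0 < D \<or> z = 0 \<Longrightarrow> x = 0 \<and> y = 0 \<and> z = 0"
proof -
  (* Completion of squares, one variable after the other. *)
  have id: "p * m * Q = m * (p * x + f * y + g * z)\<^sup>2 + (m * y + (p * h - f * g) * z)\<^sup>2
      + p * D * z\<^sup>2"
    unfolding m_def D_def Q_def by algebra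
  have nn: "0 \<le> m * (p * x + f * y + g * z)\<^sup>2" "0 \<le> (m * y + (p * h - f * g) * z)\<^sup>2"
    "0 \<le> p * D * z\<^sup>2"
    using assms(4-) by simp_all
  then have "0 \<le> p * m * Q" unfolding id by simp
  moreover have "0 < p * m" using assms(4,5) by simp
  ultimately show "0 \<le> Q" by (simp only: zero_le_mult_iff) linarith
  assume "Q = 0" and z: "0 < D \<or> z = 0"
  then have "m * (p * x + f * y + g * z)\<^sup>2 + (m * y + (p * h - f * g) * z)\<^sup>2 + p * D * z\<^sup>2 = 0"
    using id by simp
  then have "m * (p * x + f * y + g * z)\<^sup>2 = 0" "(m * y + (p * h - f * g) * z)\<^sup>2 = 0"
    "p * D * z\<^sup>2 = 0" using nn by linarith+
  then show "x = 0 \<and> y = 0 \<and> z = 0" using z assms(4,5) by auto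
qed

text \<open>Up to the positive factor \<open>1 / sqrt gram\<close>, this is the quadratic form \<open>\<Sum> d\<^sub>i \<theta>\<^sub>i'\<close> of the derivatives of the
  angles when the coordinates move with velocity \<open>d\<close>.  Corner \<open>i\<close> is opposite to side \<open>i\<close>, and the
  linear forms \<open>\<alpha>\<^sub>1 d\<^sub>2 + \<beta>\<^sub>1 d\<^sub>3\<close>, \<open>\<alpha>\<^sub>2 d\<^sub>3 + \<beta>\<^sub>2 d\<^sub>1\<close>, \<open>\<alpha>\<^sub>3 d\<^sub>1 + \<beta>\<^sub>3 d\<^sub>2\<close> are the derivatives of the three \<open>q\<^sub>i\<close>,
  divided by \<open>geo_sq \<kappa> q\<^sub>i\<close>.\<close>

definition angle_form where
  "angle_form \<kappa> q1 q2 q3 \<alpha>1 \<beta>1 \<alpha>2 \<beta>2 \<alpha>3 \<beta>3 d1 d2 d3 =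
     d1 * (geo_sq \<kappa> q1 * (\<alpha>1 * d2 + \<beta>1 * d3) - cos_num \<kappa> q3 q1 q2 * (\<alpha>2 * d3 + \<beta>2 * d1)
            - cos_num \<kappa> q2 q3 q1 * (\<alpha>3 * d1 + \<beta>3 * d2))
   + d2 * (geo_sq \<kappa> q2 * (\<alpha>2 * d3 + \<beta>2 * d1) - cos_num \<kappa> q1 q2 q3 * (\<alpha>3 * d1 + \<beta>3 * d2)
            - cos_num \<kappa> q3 q1 q2 * (\<alpha>1 * d2 + \<beta>1 * d3))
   + d3 * (geo_sq \<kappa> q3 * (\<alpha>3 * d1 + \<beta>3 * d2) - cos_num \<kappa> q2 q3 q1 * (\<alpha>1 * d2 + \<beta>1 * d3)
            - cos_num \<kappa> q1 q2 q3 * (\<alpha>2 * d3 + \<beta>2 * d1 :: real))"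

text \<open>The formulas for \<open>\<alpha>\<close> and \<open>\<beta>\<close> are those of \<open>side_coef\<close> below, for a side whose ends have radii with parameters
  \<open>x\<close> and \<open>y\<close>.  By them \<open>\<alpha>\<close> and \<open>\<beta>\<close> solve a linear system whose right-hand sides depend on a
  single radius each, which links the coefficients of adjacent sides.\<close>

lemma side_coeff:
  fixes \<kappa> q \<alpha> \<beta> x y :: real
  assumes "0 \<le> \<kappa>" "0 < q"
    and A: "geo_sq \<kappa> q * \<alpha> = (1 + \<kappa> * x) * q + x - y"
    and B: "geo_sq \<kappa> q * \<beta> = (1 + \<kappa> * y) * q + y - x"
  shows "(1 + \<kappa> * q) * \<alpha> + \<beta> = 1 + \<kappa> * x" "(1 + \<kappa> * q) * \<beta> + \<alpha> = 1 + \<kappa> * y"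
    "q * (\<alpha> - \<beta>) = x - y"
proof -
  have pos: "0 < 2 + \<kappa> * q" "0 < geo_sq \<kappa> q"
    using assms(1,2) by (auto simp: geo_sq_def add_pos_nonneg)
  have "geo_sq \<kappa> q * ((1 + \<kappa> * q) * \<alpha> + \<beta>) = geo_sq \<kappa> q * (1 + \<kappa> * x)"
    using A B unfolding geo_sq_def by algebra
  then show "(1 + \<kappa> * q) * \<alpha> + \<beta> = 1 + \<kappa> * x" using pos by simp
  have "geo_sq \<kappa> q * ((1 + \<kappa> * q) * \<beta> + \<alpha>) = geo_sq \<kappa> q * (1 + \<kappa> * y)"
    using A B unfolding geo_sq_def by algebra
  then show "(1 + \<kappa> * q) * \<beta> + \<alpha> = 1 + \<kappa> * y" using pos by simp
  have "(2 + \<kappa> * q) * (q * (\<alpha> - \<beta>)) = (2 + \<kappa> * q) * (x - y)"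
    using A B unfolding geo_sq_def by algebra
  then show "q * (\<alpha> - \<beta>) = x - y" using pos by simp
qed

text \<open>With \<open>x = c1 * \<alpha>1\<close> and \<open>y = c2 * \<beta>2\<close>, the claim follows from \<open>x * y < c3 * (x * \<alpha>3 + y * \<beta>3)\<close>.  The
  difference of its sides is bilinear in \<open>(x, y)\<close>, so it is enough to look at the corners of the
  rectangle bounded by the last two assumptions: the inequality holds weakly at all of them (at the far
  corner it amounts to \<open>1 \<le> c3\<^sup>2\<close>) and strictly at two.\<close>

lemma minor_pos:
  fixes c1 c2 c3 \<alpha>1 \<beta>2 \<alpha>3 \<beta>3 :: real
  assumes c: "1 \<le> c1" "1 \<le> c2" "1 \<le> c3" "c3 \<le> c1 * c2"
    and pos: "0 < \<alpha>1" "0 < \<beta>2" "0 < \<alpha>3" "0 < \<beta>3"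
    and x: "c1 * \<alpha>1 < c3 * \<beta>3 + \<alpha>3" and y: "c2 * \<beta>2 < c3 * \<alpha>3 + \<beta>3"
  shows "\<alpha>1 * \<beta>2 < c1 * \<alpha>1 * \<alpha>3 + c2 * \<beta>2 * \<beta>3"
proof -
  define x where "x = c1 * \<alpha>1"
  define y where "y = c2 * \<beta>2"
  have xy: "0 < x" "0 < y" "x < c3 * \<beta>3 + \<alpha>3" "y < c3 * \<alpha>3 + \<beta>3"
    using assms by (auto simp: x_def y_def)
  have main: "x * y < c3 * (x * \<alpha>3 + y * \<beta>3)"
  proof (cases "x \<le> c3 * \<beta>3")
    case True
    then have "x * y \<le> c3 * \<beta>3 * y" using xy by (intro mult_right_mono) auto
    moreover have "0 < c3 * (x * \<alpha>3)" using c pos xy by simp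
    ultimately show ?thesis by (simp add: algebra_simps)
  next
    case False
    then have "y * (x - c3 * \<beta>3) < (c3 * \<alpha>3 + \<beta>3) * (x - c3 * \<beta>3)"
      using xy by (intro mult_strict_right_mono) auto
    moreover have "0 \<le> \<beta>3 * (c3 * c3 * \<alpha>3 + c3 * \<beta>3 - x)"
    proof -
      have "1 * \<alpha>3 \<le> c3 * c3 * \<alpha>3"
        using c pos mult_mono[of 1 c3 1 c3] by (intro mult_right_mono) auto
      then have "0 \<le> c3 * c3 * \<alpha>3 + c3 * \<beta>3 - x" using xy(3) by linarith
      then show ?thesis using pos(4) by simp
    qed
    ultimately show ?thesis by (simp add: algebra_simps)
  qed
  have "c3 * (\<alpha>1 * \<beta>2) \<le> c1 * c2 * (\<alpha>1 * \<beta>2)"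
    using c pos by (intro mult_right_mono) auto
  also have "\<dots> = x * y" by (simp add: x_def y_def)
  also have "\<dots> < c3 * (x * \<alpha>3 + y * \<beta>3)" by (rule main)
  finally show ?thesis using c by (simp add: x_def y_def)
qed

text \<open>Sylvester's criterion for the matrix \<open>N * M\<close> of \<open>- angle_form\<close>, whose entries are \<open>p, q, r\<close> on and \<open>f, g, h\<close>
  off the diagonal.  The 2 by 2 minors of \<open>N\<close> are, up to sign, \<open>gram\<close> times \<open>1\<close> or one of the
  \<open>c\<^sub>i = 1 + \<kappa> q\<^sub>i\<close>, and its determinant is \<open>\<kappa> * gram\<^sup>2\<close>; so by the Cauchy-Binet formula
  the minors of the product are \<open>gram\<close> times simple polynomials in \<open>\<alpha>\<close> and \<open>\<beta>\<close>.  The last two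
  assumptions say that the angles at the corners 2 and 3 are acute.  They make the first entry positive
  and, as \<open>\<kappa> * cos_num \<kappa> q3 q1 q2 = c1 * c2 - c3\<close>, provide the inequality that \<open>minor_pos\<close> asks for.\<close>

lemma angle_form_neg_aux:
  fixes \<kappa> :: real
  assumes k: "0 \<le> \<kappa>" and q: "0 < q1" "0 < q2" "0 < q3" and G: "0 < gram \<kappa> q1 q2 q3"
    and ab: "0 < \<alpha>1" "0 < \<beta>1" "0 < \<alpha>2" "0 < \<beta>2" "0 < \<alpha>3" "0 < \<beta>3"
    and e1: "geo_sq \<kappa> q1 * \<alpha>1 = (1 + \<kappa> * x2) * q1 + x2 - x3"
      "geo_sq \<kappa> q1 * \<beta>1 = (1 + \<kappa> * x3) * q1 + x3 - x2"
    and e2: "geo_sq \<kappa> q2 * \<alpha>2 = (1 + \<kappa> * x3) * q2 + x3 - x1"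
      "geo_sq \<kappa> q2 * \<beta>2 = (1 + \<kappa> * x1) * q2 + x1 - x3"
    and e3: "geo_sq \<kappa> q3 * \<alpha>3 = (1 + \<kappa> * x1) * q3 + x1 - x2"
      "geo_sq \<kappa> q3 * \<beta>3 = (1 + \<kappa> * x2) * q3 + x2 - x1"
    and a: "0 < cos_num \<kappa> q2 q3 q1" "0 < cos_num \<kappa> q3 q1 q2"
  shows "angle_form \<kappa> q1 q2 q3 \<alpha>1 \<beta>1 \<alpha>2 \<beta>2 \<alpha>3 \<beta>3 d1 d2 d3 \<le> 0"
    and "angle_form \<kappa> q1 q2 q3 \<alpha>1 \<beta>1 \<alpha>2 \<beta>2 \<alpha>3 \<beta>3 d1 d2 d3 = 0 \<Longrightarrow>
      d1 = d2 \<and> d2 = d3 \<and> (0 < \<kappa> \<longrightarrow> d1 = 0)"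
proof -
  define S1 S2 S3 where S: "S1 = geo_sq \<kappa> q1" "S2 = geo_sq \<kappa> q2" "S3 = geo_sq \<kappa> q3"
  define a1 a2 a3 where a_def: "a1 = cos_num \<kappa> q1 q2 q3" "a2 = cos_num \<kappa> q2 q3 q1"
    "a3 = cos_num \<kappa> q3 q1 q2"
  define c1 c2 c3 where c: "c1 = 1 + \<kappa> * q1" "c2 = 1 + \<kappa> * q2" "c3 = 1 + \<kappa> * q3"
  note s1 = side_coeff[OF k q(1) e1] and s2 = side_coeff[OF k q(2) e2]
    and s3 = side_coeff[OF k q(3) e3]
  define p where "p = a3 * \<beta>2 + a2 * \<alpha>3"
  define q where "q = a3 * \<alpha>1 + a1 * \<beta>3"
  define r where "r = a2 * \<beta>1 + a1 * \<alpha>2"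
  define f where "f = a2 * \<beta>3 - S1 * \<alpha>1"
  define g where "g = a3 * \<alpha>2 - S1 * \<beta>1"
  define h where "h = a3 * \<beta>1 - S2 * \<alpha>2"
  (* The matrix is symmetric, as it must be for the angles to form a closed 1-form. *)
  have f': "f = a1 * \<alpha>3 - S2 * \<beta>2"
    using e1 e2 s3 unfolding f_def a_def S cos_num_def by algebra
  have g': "g = a1 * \<beta>2 - S3 * \<alpha>3"
    using e1 e3 s2 unfolding g_def a_def S cos_num_def by algebra
  have h': "h = a2 * \<alpha>1 - S3 * \<beta>3"
    using e2 e3 s1 unfolding h_def a_def S cos_num_def by algebra
  have form: "- angle_form \<kappa> q1 q2 q3 \<alpha>1 \<beta>1 \<alpha>2 \<beta>2 \<alpha>3 \<beta>3 d1 d2 d3 =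
      p * d1\<^sup>2 + q * d2\<^sup>2 + r * d3\<^sup>2 + 2 * f * d1 * d2 + 2 * g * d1 * d3 + 2 * h * d2 * d3"
    for d1 d2 d3
  proof -
    have "- angle_form \<kappa> q1 q2 q3 \<alpha>1 \<beta>1 \<alpha>2 \<beta>2 \<alpha>3 \<beta>3 d1 d2 d3 =
      p * d1\<^sup>2 + q * d2\<^sup>2 + r * d3\<^sup>2 + (f + (a1 * \<alpha>3 - S2 * \<beta>2)) * d1 * d2
      + (g + (a1 * \<beta>2 - S3 * \<alpha>3)) * d1 * d3 + (h + (a2 * \<alpha>1 - S3 * \<beta>3)) * d2 * d3"
      unfolding angle_form_def S[symmetric] a_def[symmetric] p_def q_def r_def f_def g_def h_def
      by (simp add: power2_eq_square algebra_simps)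
    then show ?thesis unfolding f'[symmetric] g'[symmetric] h'[symmetric] by simp
  qed
  have p: "0 < p" using ab a unfolding p_def a_def by (simp add: add_pos_pos)
  have "p * q - f * (a1 * \<alpha>3 - S2 * \<beta>2)
     = gram \<kappa> q1 q2 q3 * (c1 * \<alpha>1 * \<alpha>3 + c2 * \<beta>2 * \<beta>3 - \<alpha>1 * \<beta>2)"
    unfolding p_def q_def f_def c S a_def cos_num_def geo_sq_def gram_def by algebra
  then have m: "p * q - f\<^sup>2 = gram \<kappa> q1 q2 q3 * (c1 * \<alpha>1 * \<alpha>3 + c2 * \<beta>2 * \<beta>3 - \<alpha>1 * \<beta>2)"
    unfolding f'[symmetric] by (simp add: power2_eq_square)
  have "\<alpha>1 * \<beta>2 < c1 * \<alpha>1 * \<alpha>3 + c2 * \<beta>2 * \<beta>3"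
  proof (rule minor_pos)
    show "1 \<le> c1" "1 \<le> c2" "1 \<le> c3" using k q by (auto simp: c)
    have "0 \<le> \<kappa> * a3" using k a by (simp add: a_def)
    then show "c3 \<le> c1 * c2" unfolding c a_def cos_num_def by (simp add: algebra_simps)
    show "c1 * \<alpha>1 < c3 * \<beta>3 + \<alpha>3" "c2 * \<beta>2 < c3 * \<alpha>3 + \<beta>3"
      using s1 s2 s3 ab unfolding c by linarith+
  qed (use ab in auto)
  then have m: "0 < p * q - f\<^sup>2" unfolding m using G by simp
  have det': "p * q * r + f * h * (a1 * \<beta>2 - S3 * \<alpha>3) + g * (a1 * \<alpha>3 - S2 * \<beta>2) * (a2 * \<alpha>1 - S3 * \<beta>3)
      - p * h * (a2 * \<alpha>1 - S3 * \<beta>3) - q * g * (a1 * \<beta>2 - S3 * \<alpha>3) - r * f * (a1 * \<alpha>3 - S2 * \<beta>2)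
     = (a1\<^sup>2 * S1 + a2\<^sup>2 * S2 + a3\<^sup>2 * S3 + 2 * a1 * a2 * a3 - S1 * S2 * S3)
       * (\<alpha>1 * \<alpha>2 * \<alpha>3 + \<beta>1 * \<beta>2 * \<beta>3)"
    unfolding p_def q_def r_def f_def g_def h_def by algebra
  have detN: "a1\<^sup>2 * S1 + a2\<^sup>2 * S2 + a3\<^sup>2 * S3 + 2 * a1 * a2 * a3 - S1 * S2 * S3
      = \<kappa> * (gram \<kappa> q1 q2 q3)\<^sup>2"
    unfolding S a_def cos_num_def geo_sq_def gram_def by algebra
  have det: "p * q * r + 2 * f * g * h - p * h\<^sup>2 - q * g\<^sup>2 - r * f\<^sup>2
     = \<kappa> * (gram \<kappa> q1 q2 q3)\<^sup>2 * (\<alpha>1 * \<alpha>2 * \<alpha>3 + \<beta>1 * \<beta>2 * \<beta>3)"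
    using det' unfolding f'[symmetric] g'[symmetric] h'[symmetric] detN
    by (simp add: power2_eq_square algebra_simps)
  have M: "0 < \<alpha>1 * \<alpha>2 * \<alpha>3 + \<beta>1 * \<beta>2 * \<beta>3" using ab by (simp add: add_pos_pos)
  then have det0: "0 \<le> p * q * r + 2 * f * g * h - p * h\<^sup>2 - q * g\<^sup>2 - r * f\<^sup>2"
    unfolding det using k by simp
  show "angle_form \<kappa> q1 q2 q3 \<alpha>1 \<beta>1 \<alpha>2 \<beta>2 \<alpha>3 \<beta>3 d1 d2 d3 \<le> 0"
    using sylvester3(1)[OF p m det0, of d1 d2 d3] form[of d1 d2 d3] by simp
  assume 0: "angle_form \<kappa> q1 q2 q3 \<alpha>1 \<beta>1 \<alpha>2 \<beta>2 \<alpha>3 \<beta>3 d1 d2 d3 = 0"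
  show "d1 = d2 \<and> d2 = d3 \<and> (0 < \<kappa> \<longrightarrow> d1 = 0)"
  proof (cases "0 < \<kappa>")
    case True
    then have "0 < p * q * r + 2 * f * g * h - p * h\<^sup>2 - q * g\<^sup>2 - r * f\<^sup>2"
      unfolding det using G M by simp
    then show ?thesis using sylvester3(2)[OF p m det0, of d1 d2 d3] form[of d1 d2 d3] 0 by simp
  next
    case False
    then have k0: "\<kappa> = 0" using k by simp
    (* The Euclidean angles are invariant under scaling, that is, under equal shifts of the d. *)
    have b: "\<beta>1 = 1 - \<alpha>1" "\<beta>2 = 1 - \<alpha>2" "\<beta>3 = 1 - \<alpha>3" using s1 s2 s3 k0 by auto
    have "angle_form \<kappa> q1 q2 q3 \<alpha>1 \<beta>1 \<alpha>2 \<beta>2 \<alpha>3 \<beta>3 (d1 - d3) (d2 - d3) 0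
        = angle_form \<kappa> q1 q2 q3 \<alpha>1 \<beta>1 \<alpha>2 \<beta>2 \<alpha>3 \<beta>3 d1 d2 d3"
      unfolding k0 b angle_form_def geo_sq_def cos_num_def by algebra
    then show ?thesis
      using sylvester3(2)[OF p m det0, of "d1 - d3" "d2 - d3" 0] form[of "d1 - d3" "d2 - d3" 0] 0 k0
      by simp
  qed
qed

text \<open>A triangle has at most one angle that is not acute.\<close>

lemma cos_num_add_pos:
  assumes "0 \<le> \<kappa>" "0 < x" "0 < y" "0 < z"
  shows "0 < cos_num \<kappa> x y z + cos_num \<kappa> y z x"
proof -
  have "cos_num \<kappa> x y z + cos_num \<kappa> y z x = z * (2 + \<kappa> * (x + y))"
    by (simp add: cos_num_def algebra_simps)
  then show ?thesis using assms by (simp add: add_pos_nonneg)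
qed

lemma angle_form_rotate:
  "angle_form \<kappa> q2 q3 q1 \<alpha>2 \<beta>2 \<alpha>3 \<beta>3 \<alpha>1 \<beta>1 d2 d3 d1 = angle_form \<kappa> q1 q2 q3 \<alpha>1 \<beta>1 \<alpha>2 \<beta>2 \<alpha>3 \<beta>3 d1 d2 d3"
  unfolding angle_form_def by simp

lemma angle_form_neg:
  fixes \<kappa> :: real
  assumes k: "0 \<le> \<kappa>" and q: "0 < q1" "0 < q2" "0 < q3" and G: "0 < gram \<kappa> q1 q2 q3"
    and ab: "0 < \<alpha>1" "0 < \<beta>1" "0 < \<alpha>2" "0 < \<beta>2" "0 < \<alpha>3" "0 < \<beta>3"
    and e1: "geo_sq \<kappa> q1 * \<alpha>1 = (1 + \<kappa> * x2) * q1 + x2 - x3"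
      "geo_sq \<kappa> q1 * \<beta>1 = (1 + \<kappa> * x3) * q1 + x3 - x2"
    and e2: "geo_sq \<kappa> q2 * \<alpha>2 = (1 + \<kappa> * x3) * q2 + x3 - x1"
      "geo_sq \<kappa> q2 * \<beta>2 = (1 + \<kappa> * x1) * q2 + x1 - x3"
    and e3: "geo_sq \<kappa> q3 * \<alpha>3 = (1 + \<kappa> * x1) * q3 + x1 - x2"
      "geo_sq \<kappa> q3 * \<beta>3 = (1 + \<kappa> * x2) * q3 + x2 - x1"
  shows "angle_form \<kappa> q1 q2 q3 \<alpha>1 \<beta>1 \<alpha>2 \<beta>2 \<alpha>3 \<beta>3 d1 d2 d3 \<le> 0 \<and>
    (angle_form \<kappa> q1 q2 q3 \<alpha>1 \<beta>1 \<alpha>2 \<beta>2 \<alpha>3 \<beta>3 d1 d2 d3 = 0 \<longrightarrow>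
      d1 = d2 \<and> d2 = d3 \<and> (0 < \<kappa> \<longrightarrow> d1 = 0))"
proof -
  define a1 where "a1 = cos_num \<kappa> q1 q2 q3"
  define a2 where "a2 = cos_num \<kappa> q2 q3 q1"
  define a3 where "a3 = cos_num \<kappa> q3 q1 q2"
  have sum: "0 < a1 + a2" "0 < a2 + a3" "0 < a3 + a1"
    using cos_num_add_pos[OF k, of q1 q2 q3] cos_num_add_pos[OF k, of q2 q3 q1]
      cos_num_add_pos[OF k, of q3 q1 q2] q by (auto simp: a1_def a2_def a3_def)
  then consider "0 < a2" "0 < a3" | "0 < a3" "0 < a1" | "0 < a1" "0 < a2" by linarith
  then show ?thesis
  proof cases
    case 1
    then show ?thesis
      using angle_form_neg_aux[OF k q G ab e1 e2 e3, of d1 d2 d3] unfolding a1_def a2_def a3_def by blast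
  next
    case 2
    have "0 < gram \<kappa> q2 q3 q1" using G by (simp add: gram_rotate)
    from angle_form_neg_aux[OF k q(2,3,1) this ab(3-6,1,2) e2 e3 e1, of d2 d3 d1] 2
    show ?thesis unfolding a1_def a2_def a3_def
      using angle_form_rotate[of \<kappa> q2 q3 q1 \<alpha>2 \<beta>2 \<alpha>3 \<beta>3 \<alpha>1 \<beta>1 d2 d3 d1] by auto
  next
    case 3
    have "0 < gram \<kappa> q3 q1 q2" using G by (metis gram_rotate)
    from angle_form_neg_aux[OF k q(3,1,2) this ab(5,6,1-4) e3 e1 e2, of d3 d1 d2] 3
    show ?thesis unfolding a1_def a2_def a3_def
      using angle_form_rotate[of \<kappa> q3 q1 q2 \<alpha>3 \<beta>3 \<alpha>1 \<beta>1 \<alpha>2 \<beta>2 d3 d1 d2]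
        angle_form_rotate[of \<kappa> q2 q3 q1 \<alpha>2 \<beta>2 \<alpha>3 \<beta>3 \<alpha>1 \<beta>1 d2 d3 d1] by auto
  qed
qed

section \<open>Differentiation and degeneration of the angles\<close>

lemma geo_sq_pos: "0 \<le> \<kappa> \<Longrightarrow> 0 < q \<Longrightarrow> 0 < geo_sq \<kappa> q"
  by (simp add: geo_sq_def add_pos_nonneg)

lemma nondegenerate_iff:
  assumes "0 \<le> \<kappa>" "0 < y" "0 < z"
  shows "0 < gram \<kappa> x y z \<longleftrightarrow> \<bar>cos_num \<kappa> x y z / sqrt (geo_sq \<kappa> y * geo_sq \<kappa> z)\<bar> < 1"
proof -
  have P: "0 < geo_sq \<kappa> y * geo_sq \<kappa> z" using assms by (simp add: geo_sq_pos)
  have "\<bar>cos_num \<kappa> x y z / sqrt (geo_sq \<kappa> y * geo_sq \<kappa> z)\<bar> < 1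
      \<longleftrightarrow> \<bar>cos_num \<kappa> x y z\<bar> < \<bar>sqrt (geo_sq \<kappa> y * geo_sq \<kappa> z)\<bar>"
    using P by (simp add: abs_divide)
  also have "\<dots> \<longleftrightarrow> (cos_num \<kappa> x y z)\<^sup>2 < geo_sq \<kappa> y * geo_sq \<kappa> z"
    using P abs_le_square_iff[of "sqrt (geo_sq \<kappa> y * geo_sq \<kappa> z)" "cos_num \<kappa> x y z"]
    by (auto simp: not_le[symmetric])
  finally show ?thesis using gram_eq[of \<kappa> y z x] by auto
qed

lemma ext_angle_degenerate:
  assumes "0 \<le> \<kappa>" "0 < y" "0 < z" "gram \<kappa> x y z \<le> 0"
  shows "ext_angle \<kappa> x y z \<in> {0, pi}"
  using nondegenerate_iff[OF assms(1-3), of x] assms(4)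
  by (auto simp: ext_angle_def not_less[symmetric] min_def max_def abs_if split: if_splits)

text \<open>The derivative of the cosine law.  Together, the formulas for the three angles form the matrix \<open>- N\<close> of
  the section above, applied to the quotients \<open>q\<^sub>i' / geo_sq \<kappa> q\<^sub>i\<close>.\<close>

lemma ext_angle_deriv:
  fixes x y z :: "real \<Rightarrow> real"
  assumes k: "0 \<le> \<kappa>"
    and der: "(x has_real_derivative x') (at s)" "(y has_real_derivative y') (at s)"
      "(z has_real_derivative z') (at s)"
    and pos: "0 < y s" "0 < z s"
    and G: "0 < gram \<kappa> (x s) (y s) (z s)"
  shows "((\<lambda>s. ext_angle \<kappa> (x s) (y s) (z s)) has_real_derivative
     (x' - cos_num \<kappa> (z s) (x s) (y s) * (y' / geo_sq \<kappa> (y s))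
         - cos_num \<kappa> (y s) (z s) (x s) * (z' / geo_sq \<kappa> (z s))) / sqrt (gram \<kappa> (x s) (y s) (z s))) (at s)"
    (is "(_ has_real_derivative ?D) _")
proof -
  define w where "w s = cos_num \<kappa> (x s) (y s) (z s) / sqrt (geo_sq \<kappa> (y s) * geo_sq \<kappa> (z s))" for s
  define N where "N = cos_num \<kappa> (x s) (y s) (z s)"
  define N' where "N' = y' + z' - x' + \<kappa> * (y' * z s + y s * z')"
  define Y where "Y = geo_sq \<kappa> (y s)"
  define Z where "Z = geo_sq \<kappa> (z s)"
  define Y' where "Y' = 2 * (1 + \<kappa> * y s) * y'"
  define Z' where "Z' = 2 * (1 + \<kappa> * z s) * z'"
  define g where "g = gram \<kappa> (x s) (y s) (z s)"
  have YZ: "0 < Y" "0 < Z" using pos k by (auto simp: Y_def Z_def geo_sq_pos)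
  have g: "0 < g" "Y * Z - N\<^sup>2 = g" using G gram_eq by (auto simp: g_def Y_def Z_def N_def)
  have dN: "((\<lambda>s. cos_num \<kappa> (x s) (y s) (z s)) has_real_derivative N') (at s)"
    unfolding cos_num_def N'_def by (auto intro!: derivative_eq_intros der simp: algebra_simps)
  have dY: "((\<lambda>s. geo_sq \<kappa> (y s)) has_real_derivative Y') (at s)"
    unfolding geo_sq_def Y'_def by (auto intro!: derivative_eq_intros der simp: algebra_simps)
  have dZ: "((\<lambda>s. geo_sq \<kappa> (z s)) has_real_derivative Z') (at s)"
    unfolding geo_sq_def Z'_def by (auto intro!: derivative_eq_intros der simp: algebra_simps)
  have dP: "((\<lambda>s. geo_sq \<kappa> (y s) * geo_sq \<kappa> (z s)) has_real_derivative Y' * Z + Z' * Y) (at s)"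
    using DERIV_mult[OF dY dZ] by (simp add: Y_def Z_def)
  have P: "0 < geo_sq \<kappa> (y s) * geo_sq \<kappa> (z s)" using YZ by (simp add: Y_def Z_def)
  have dS: "((\<lambda>s. sqrt (geo_sq \<kappa> (y s) * geo_sq \<kappa> (z s))) has_real_derivative
      (Y' * Z + Z' * Y) / (2 * sqrt (Y * Z))) (at s)"
    using DERIV_chain2[OF DERIV_real_sqrt[OF P] dP] unfolding Y_def[symmetric] Z_def[symmetric]
    by (rule DERIV_cong) (simp add: divide_simps)
  have dw: "(w has_real_derivative
      (N' * sqrt (Y * Z) - N * ((Y' * Z + Z' * Y) / (2 * sqrt (Y * Z)))) / (Y * Z)) (at s)"
    using DERIV_divide[OF dN dS] P YZ unfolding w_def[abs_def]
    by (simp add: N_def Y_def Z_def)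
  have ws: "w s = N / sqrt (Y * Z)" by (simp add: w_def N_def Y_def Z_def)
  have w1: "\<bar>w s\<bar> < 1" unfolding w_def using nondegenerate_iff[OF k pos] G by simp
  have "1 - (w s)\<^sup>2 = g / (Y * Z)"
    using YZ by (simp add: ws power_divide g(2)[symmetric] field_simps)
  then have sq: "sqrt (1 - (w s)\<^sup>2) = sqrt g / sqrt (Y * Z)" by (simp add: real_sqrt_divide)
  have "((\<lambda>s. arccos (w s)) has_real_derivative inverse (- sqrt (1 - (w s)\<^sup>2)) *
      ((N' * sqrt (Y * Z) - N * ((Y' * Z + Z' * Y) / (2 * sqrt (Y * Z)))) / (Y * Z))) (at s)"
    using w1 by (intro DERIV_chain2[OF DERIV_arccos dw]) auto
  also have "inverse (- sqrt (1 - (w s)\<^sup>2)) *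
      ((N' * sqrt (Y * Z) - N * ((Y' * Z + Z' * Y) / (2 * sqrt (Y * Z)))) / (Y * Z)) = ?D"
  proof -
    define R where "R = sqrt (Y * Z)"
    have R: "R \<noteq> 0" "R * R = Y * Z" using YZ by (auto simp: R_def)
    have "inverse (- (sqrt g / R)) * ((N' * R - N * ((Y' * Z + Z' * Y) / (2 * R))) / (Y * Z))
        = - (N' * (R * R) - N * (Y' * Z + Z' * Y) / 2) / (sqrt g * (Y * Z))"
    proof -
      have "inverse (- (sqrt g / R)) = - (R / sqrt g)" by simp
      moreover have "- (R / sqrt g) * ((N' * R - N * (V / (2 * R))) / W) = - (N' * (R * R) - N * V / 2) / (sqrt g * W)"
        for V W using R(1) g(1) by (cases "W = 0") (simp_all add: field_simps)
      ultimately show ?thesis by simp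
    qed
    also have "\<dots> = - (N' - N * (Y' / 2 / Y + Z' / 2 / Z)) / sqrt g"
    proof -
      have "N' * (Y * Z) - N * (Y' * Z + Z' * Y) / 2 = (N' - N * (Y' / 2 / Y + Z' / 2 / Z)) * (Y * Z)"
        using YZ by (simp add: field_simps)
      then have "- (N' * (Y * Z) - N * (Y' * Z + Z' * Y) / 2) / (sqrt g * (Y * Z))
          = (- (N' - N * (Y' / 2 / Y + Z' / 2 / Z)) * (Y * Z)) / (sqrt g * (Y * Z))"
        by (simp only: mult_minus_left)
      also have "\<dots> = - (N' - N * (Y' / 2 / Y + Z' / 2 / Z)) / sqrt g"
        using YZ by (intro mult_divide_mult_cancel_right) auto
      finally show ?thesis unfolding R(2) .
    qed
    also have "- (N' - N * (Y' / 2 / Y + Z' / 2 / Z)) =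
      x' - cos_num \<kappa> (z s) (x s) (y s) * (y' / Y) - cos_num \<kappa> (y s) (z s) (x s) * (z' / Z)"
    proof -
      have "cos_num \<kappa> (z s) (x s) (y s) = (1 + \<kappa> * z s) * Y - N * (1 + \<kappa> * y s)"
        "cos_num \<kappa> (y s) (z s) (x s) = (1 + \<kappa> * y s) * Z - N * (1 + \<kappa> * z s)"
        unfolding cos_num_def N_def Y_def Z_def geo_sq_def by algebra+
      then have "cos_num \<kappa> (z s) (x s) (y s) * (y' / Y) = (1 + \<kappa> * z s) * y' - N * (Y' / 2 / Y)"
        "cos_num \<kappa> (y s) (z s) (x s) * (z' / Z) = (1 + \<kappa> * y s) * z' - N * (Z' / 2 / Z)"
        using YZ by (simp_all only: Y'_def Z'_def) (simp_all add: field_simps)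
      then show ?thesis unfolding N'_def by (simp add: algebra_simps)
    qed
    finally show ?thesis unfolding sq R_def[symmetric] by (simp add: g_def Y_def Z_def)
  qed
  finally have D: "((\<lambda>s. arccos (w s)) has_real_derivative ?D) (at s)" .
  (* Near s the clamp is inactive. *)
  have "isCont (\<lambda>s. \<bar>w s\<bar>) s" using DERIV_isCont[OF dw] by (rule isCont_rabs)
  then have "eventually (\<lambda>s. \<bar>w s\<bar> < 1) (at s)"
    using w1 unfolding isCont_def by (rule order_tendstoD)
  then have "eventually (\<lambda>s. \<bar>w s\<bar> < 1) (nhds s)" using w1
    by (auto simp: eventually_at_filter elim!: eventually_mono)
  then have "eventually (\<lambda>s. ext_angle \<kappa> (x s) (y s) (z s) = arccos (w s)) (nhds s)"
    by eventually_elim (auto simp: ext_angle_def w_def[symmetric] min_def max_def)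
  from DERIV_cong_ev[OF refl this refl] D show ?thesis by (rule iffD2)
qed

text \<open>If \<open>g\<close> grew from \<open>a\<close> to \<open>b\<close>, it would cross an interval of values that avoids \<open>Y\<close>.  Between the last
  time below that interval and the first later time above it, \<open>g\<close> stays inside, so its derivative is
  not positive there, which contradicts the growth.\<close>

lemma nonincreasing_off_finite_set:
  fixes g :: "real \<Rightarrow> real"
  assumes ab: "a \<le> b" and cont: "continuous_on {a..b} g" and Y: "finite Y"
    and der: "\<And>s. a < s \<Longrightarrow> s < b \<Longrightarrow> g s \<notin> Y \<Longrightarrow> \<exists>D\<le>0. (g has_real_derivative D) (at s)"
  shows "g b \<le> g a"
proof (rule ccontr)
  assume "\<not> g b \<le> g a"
  then have less: "g a < g b" by simp
  then have "infinite ({g a<..<g b} - Y)" using Y by (simp add: infinite_Ioo)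
  then obtain y1 where y1: "g a < y1" "y1 < g b" "y1 \<notin> Y"
    by (metis DiffE finite.emptyI greaterThanLessThan_iff equals0I)
  have "open (- Y)" using Y by (simp add: finite_imp_closed open_Compl)
  then obtain e where e: "0 < e" "\<And>y. dist y y1 < e \<Longrightarrow> y \<notin> Y"
    using y1(3) unfolding open_dist by auto
  define y2 where "y2 = min (g b) (y1 + e)"
  have y2: "y1 < y2" "y2 \<le> g b" using y1 e by (auto simp: y2_def)
  have off: "y \<notin> Y" if "y1 < y" "y < y2" for y
    using that by (intro e) (auto simp: y2_def dist_real_def)
  have "compact ({a..b} \<inter> g -` {..y1})"
    using continuous_closed_preimage[OF cont] by (auto simp: compact_eq_bounded_closed bounded_Int)
  moreover have "a \<in> {a..b} \<inter> g -` {..y1}" using ab y1 by auto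
  ultimately have "\<exists>p \<in> {a..b} \<inter> g -` {..y1}. \<forall>s \<in> {a..b} \<inter> g -` {..y1}. s \<le> p"
    by (intro compact_attains_sup) auto
  then obtain p where p: "p \<in> {a..b}" "g p \<le> y1" "\<And>s. s \<in> {a..b} \<Longrightarrow> g s \<le> y1 \<Longrightarrow> s \<le> p"
    by auto
  have cont': "continuous_on {p..b} g" using cont p by (auto intro: continuous_on_subset)
  have "compact ({p..b} \<inter> g -` {y2..})"
    using continuous_closed_preimage[OF cont'] by (auto simp: compact_eq_bounded_closed bounded_Int)
  moreover have "b \<in> {p..b} \<inter> g -` {y2..}" using p y2 by auto
  ultimately have "\<exists>q \<in> {p..b} \<inter> g -` {y2..}. \<forall>s \<in> {p..b} \<inter> g -` {y2..}. q \<le> s"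
    by (intro compact_attains_inf) auto
  then obtain q where q: "q \<in> {p..b}" "y2 \<le> g q" "\<And>s. s \<in> {p..b} \<Longrightarrow> y2 \<le> g s \<Longrightarrow> q \<le> s"
    by auto
  have "p \<noteq> q" using p(2) q(2) y2(1) by auto
  then have "p < q" using q(1) by simp
  moreover have "\<exists>D. (g has_real_derivative D) (at s) \<and> D \<le> 0" if "p < s" "s < q" for s
  proof -
    have "y1 < g s" using p(3)[of s] p(1) q(1) that by force
    moreover have "g s < y2" using q(3)[of s] q(1) that by force
    ultimately have "g s \<notin> Y" by (rule off)
    moreover have "a < s" "s < b" using p(1) q(1) that by auto
    ultimately show ?thesis using der[of s] by blast
  qed
  moreover have "continuous_on {p..q} g" using cont' q by (auto intro: continuous_on_subset)
  ultimately have "g q \<le> g p"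
    using DERIV_nonpos_imp_decreasing_open[of p q g] by auto
  then show False using p(2) q(2) y2(1) by simp
qed


section \<open>Lengths as functions of the radii\<close>

text \<open>For \<open>\<kappa> = 1\<close> and \<open>exp u = tanh (r / 2)\<close> the next two functions are \<open>cosh r - 1\<close> and \<open>sinh r\<close>; for \<open>\<kappa> = 0\<close> and
  \<open>exp u = r / 2\<close> they are \<open>r\<^sup>2 / 2\<close> and \<open>r\<close>.\<close>

definition rad_cosh :: "real \<Rightarrow> real \<Rightarrow> real" where
  "rad_cosh \<kappa> u = 2 * (exp u)\<^sup>2 / (1 - \<kappa> * (exp u)\<^sup>2)"

definition rad_sinh :: "real \<Rightarrow> real \<Rightarrow> real" where
  "rad_sinh \<kappa> u = 2 * exp u / (1 - \<kappa> * (exp u)\<^sup>2)"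

text \<open>The parameter \<open>q\<close> of the side of inversive distance \<open>\<eta>\<close> between the circles \<open>u\<close> and \<open>v\<close>.\<close>

definition side :: "real \<Rightarrow> real \<Rightarrow> real \<Rightarrow> real \<Rightarrow> real" where
  "side \<kappa> \<eta> u v = rad_cosh \<kappa> u + rad_cosh \<kappa> v + \<kappa> * rad_cosh \<kappa> u * rad_cosh \<kappa> v
     + \<eta> * rad_sinh \<kappa> u * rad_sinh \<kappa> v"

text \<open>In the hyperbolic case only \<open>exp u < 1\<close> comes from a radius.\<close>

definition admissible :: "real \<Rightarrow> real \<Rightarrow> bool" where
  "admissible \<kappa> u \<longleftrightarrow> \<kappa> * (exp u)\<^sup>2 < 1"

text \<open>The partial derivative of \<open>side \<kappa> \<eta> u v\<close> by \<open>u\<close> (see \<open>side_deriv\<close>), in the form in which it enters the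
  algebra of the Jacobian: the inversive distance occurs only through the side itself.\<close>

definition side_coef :: "real \<Rightarrow> real \<Rightarrow> real \<Rightarrow> real \<Rightarrow> real" where
  "side_coef \<kappa> \<eta> u v = (1 + \<kappa> * rad_cosh \<kappa> u) * side \<kappa> \<eta> u v + rad_cosh \<kappa> u - rad_cosh \<kappa> v"

lemma side_commute: "side \<kappa> \<eta> u v = side \<kappa> \<eta> v u"
  by (simp add: side_def)

lemma rad_pos:
  assumes "admissible \<kappa> u" shows "0 < rad_cosh \<kappa> u" "0 < rad_sinh \<kappa> u"
  using assms by (auto simp: admissible_def rad_cosh_def rad_sinh_def)

lemma rad_sinh_sq:
  assumes "admissible \<kappa> u"
  shows "(rad_sinh \<kappa> u)\<^sup>2 = rad_cosh \<kappa> u * (2 + \<kappa> * rad_cosh \<kappa> u)"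
proof -
  define D where "D = 1 - \<kappa> * (exp u)\<^sup>2"
  have "D \<noteq> 0" using assms by (simp add: admissible_def D_def)
  then have "rad_cosh \<kappa> u * (2 + \<kappa> * rad_cosh \<kappa> u) = 4 * (exp u)\<^sup>2 * (D + \<kappa> * (exp u)\<^sup>2) / D\<^sup>2"
    unfolding rad_cosh_def D_def[symmetric] by (simp add: field_simps power2_eq_square)
  also have "D + \<kappa> * (exp u)\<^sup>2 = 1" by (simp add: D_def)
  finally show ?thesis unfolding rad_sinh_def D_def[symmetric] by (simp add: power_divide power_mult_distrib)
qed

lemma rad_cosh_deriv:
  assumes "admissible \<kappa> u"
  shows "(rad_cosh \<kappa> has_real_derivative (rad_sinh \<kappa> u)\<^sup>2) (at u)"
proof -
  define D where "D = 1 - \<kappa> * (exp u)\<^sup>2"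
  have D: "D \<noteq> 0" using assms by (simp add: admissible_def D_def)
  have "(rad_cosh \<kappa> has_real_derivative
     (2 * (2 * exp u * exp u) * D - 2 * (exp u)\<^sup>2 * (0 - \<kappa> * (2 * exp u * exp u))) / (D * D)) (at u)"
    unfolding rad_cosh_def[abs_def] D_def
    by (rule DERIV_divide) (use D in \<open>auto intro!: derivative_eq_intros simp: D_def\<close>)
  also have "2 * (2 * exp u * exp u) * D - 2 * (exp u)\<^sup>2 * (0 - \<kappa> * (2 * exp u * exp u)) = (2 * exp u)\<^sup>2"
    unfolding D_def by algebra
  finally show ?thesis unfolding rad_sinh_def D_def[symmetric]
    by (simp add: power_divide power2_eq_square[of D])
qed

lemma rad_sinh_deriv:
  assumes "admissible \<kappa> u"
  shows "(rad_sinh \<kappa> has_real_derivative (1 + \<kappa> * rad_cosh \<kappa> u) * rad_sinh \<kappa> u) (at u)"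
proof -
  define D where "D = 1 - \<kappa> * (exp u)\<^sup>2"
  have D: "D \<noteq> 0" using assms by (simp add: admissible_def D_def)
  have "(rad_sinh \<kappa> has_real_derivative
     (2 * exp u * D - 2 * exp u * (0 - \<kappa> * (2 * exp u * exp u))) / (D * D)) (at u)"
    unfolding rad_sinh_def[abs_def] D_def
    by (rule DERIV_divide) (use D in \<open>auto intro!: derivative_eq_intros simp: D_def\<close>)
  also have "2 * exp u * D - 2 * exp u * (0 - \<kappa> * (2 * exp u * exp u)) = (D + \<kappa> * (2 * (exp u)\<^sup>2)) * (2 * exp u)"
    by algebra
  also have "\<dots> / (D * D) = (1 + \<kappa> * (2 * (exp u)\<^sup>2 / D)) * (2 * exp u / D)"
    using D by (simp add: field_simps)
  finally show ?thesis unfolding rad_sinh_def rad_cosh_def D_def .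
qed

lemma side_pos:
  assumes "0 \<le> \<kappa>" "0 \<le> \<eta>" "admissible \<kappa> u" "admissible \<kappa> v"
  shows "0 < side \<kappa> \<eta> u v"
  using assms rad_pos[OF assms(3)] rad_pos[OF assms(4)]
  unfolding side_def by (intro add_pos_nonneg) auto

lemma side_coef_eq:
  assumes "admissible \<kappa> u"
  shows "side_coef \<kappa> \<eta> u v = (rad_sinh \<kappa> u)\<^sup>2 * (1 + \<kappa> * rad_cosh \<kappa> v)
     + \<eta> * rad_sinh \<kappa> u * rad_sinh \<kappa> v * (1 + \<kappa> * rad_cosh \<kappa> u)"
  unfolding side_coef_def side_def rad_sinh_sq[OF assms] by (simp add: algebra_simps)

text \<open>This is the place where \<open>0 \<le> \<eta>\<close> is essential: growing circles lengthen the sides.\<close>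

lemma side_coef_pos:
  assumes "0 \<le> \<kappa>" "0 \<le> \<eta>" "admissible \<kappa> u" "admissible \<kappa> v"
  shows "0 < side_coef \<kappa> \<eta> u v"
  using assms rad_pos[OF assms(3)] rad_pos[OF assms(4)]
  unfolding side_coef_eq[OF assms(3)] by (intro add_pos_nonneg mult_pos_pos mult_nonneg_nonneg) auto

lemma side_deriv:
  fixes u v :: "real \<Rightarrow> real"
  assumes adm: "admissible \<kappa> (u s)" "admissible \<kappa> (v s)"
    and der: "(u has_real_derivative d) (at s)" "(v has_real_derivative e) (at s)"
  shows "((\<lambda>s. side \<kappa> \<eta> (u s) (v s)) has_real_derivative
     side_coef \<kappa> \<eta> (u s) (v s) * d + side_coef \<kappa> \<eta> (v s) (u s) * e) (at s)"
proof -
  note d = DERIV_chain2[OF rad_cosh_deriv[OF adm(1)] der(1)] DERIV_chain2[OF rad_cosh_deriv[OF adm(2)] der(2)]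
    DERIV_chain2[OF rad_sinh_deriv[OF adm(1)] der(1)] DERIV_chain2[OF rad_sinh_deriv[OF adm(2)] der(2)]
  show ?thesis
    unfolding side_def by (auto intro!: derivative_eq_intros d
      simp: side_coef_eq[OF adm(1)] side_coef_eq[OF adm(2)] power2_eq_square algebra_simps)
qed

lemma admissible_segment:
  assumes "0 \<le> \<kappa>" "admissible \<kappa> u" "admissible \<kappa> v" "0 \<le> s" "s \<le> 1"
  shows "admissible \<kappa> (u + s * (v - u))"
proof -
  have "u + s * (v - u) = (1 - s) * u + s * v" by (simp add: algebra_simps)
  also have "\<dots> \<le> max u v"
    using convex_bound_le[of u "max u v" v "1 - s" s] assms by simp
  finally have "exp (u + s * (v - u)) \<le> max (exp u) (exp v)"
    by (metis exp_le_cancel_iff le_max_iff_disj)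
  then have "(exp (u + s * (v - u)))\<^sup>2 \<le> (max (exp u) (exp v))\<^sup>2" by (intro power_mono) auto
  then have "\<kappa> * (exp (u + s * (v - u)))\<^sup>2 \<le> \<kappa> * (max (exp u) (exp v))\<^sup>2"
    using assms(1) by (rule mult_left_mono)
  also have "\<dots> < 1" using assms by (auto simp: admissible_def max_def)
  finally show ?thesis by (simp add: admissible_def)
qed

lemma ext_angle_continuous:
  assumes k: "0 \<le> \<kappa>"
    and cont: "continuous_on A x" "continuous_on A y" "continuous_on A z"
    and pos: "\<And>s. s \<in> A \<Longrightarrow> 0 < y s" "\<And>s. s \<in> A \<Longrightarrow> 0 < z s"
  shows "continuous_on A (\<lambda>s. ext_angle \<kappa> (x s) (y s) (z s))"
proof -
  have "geo_sq \<kappa> (y s) * geo_sq \<kappa> (z s) \<noteq> 0" if "s \<in> A" for s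
    using geo_sq_pos[OF k pos(1)[OF that]] geo_sq_pos[OF k pos(2)[OF that]] by simp
  then have "continuous_on A (\<lambda>s. cos_num \<kappa> (x s) (y s) (z s) / sqrt (geo_sq \<kappa> (y s) * geo_sq \<kappa> (z s)))"
    by (intro continuous_on_divide continuous_on_real_sqrt)
      (auto simp: cos_num_def geo_sq_def intro!: continuous_intros cont)
  then show ?thesis
    unfolding ext_angle_def
    by (intro continuous_on_arccos continuous_on_max continuous_on_min continuous_on_const) auto
qed

section \<open>Monotonicity of the angles of one triangle\<close>

text \<open>The quantity \<open>Q\<close> is the increment over \<open>{0..1}\<close> of the function \<open>g\<close>, the sum of the extended angles along the
  segment from \<open>u\<close> to \<open>v\<close> with the weights \<open>v - u\<close>.  Its derivative is a positive multiple of
  \<open>angle_form\<close> at the nondegenerate times, and its values at the others are sums of some of the weights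
  times \<open>\<pi>\<close>.  Nondegeneracy at the start makes \<open>g\<close> drop strictly unless \<open>v - u\<close> is in the kernel.\<close>

lemma triangle_angles_monotone:
  fixes \<kappa> :: real and \<eta>1 \<eta>2 \<eta>3 u1 u2 u3 v1 v2 v3
  defines "\<theta>1 \<equiv> \<lambda>w1 w2 w3. ext_angle \<kappa> (side \<kappa> \<eta>1 w2 w3) (side \<kappa> \<eta>2 w3 w1) (side \<kappa> \<eta>3 w1 w2)"
    and "\<theta>2 \<equiv> \<lambda>w1 w2 w3. ext_angle \<kappa> (side \<kappa> \<eta>2 w3 w1) (side \<kappa> \<eta>3 w1 w2) (side \<kappa> \<eta>1 w2 w3)"
    and "\<theta>3 \<equiv> \<lambda>w1 w2 w3. ext_angle \<kappa> (side \<kappa> \<eta>3 w1 w2) (side \<kappa> \<eta>1 w2 w3) (side \<kappa> \<eta>2 w3 w1)"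
  defines "Q \<equiv> (\<theta>1 v1 v2 v3 - \<theta>1 u1 u2 u3) * (v1 - u1) + (\<theta>2 v1 v2 v3 - \<theta>2 u1 u2 u3) * (v2 - u2)
       + (\<theta>3 v1 v2 v3 - \<theta>3 u1 u2 u3) * (v3 - u3)"
  assumes k: "0 \<le> \<kappa>" and \<eta>: "0 \<le> \<eta>1" "0 \<le> \<eta>2" "0 \<le> \<eta>3"
    and u: "admissible \<kappa> u1" "admissible \<kappa> u2" "admissible \<kappa> u3"
    and v: "admissible \<kappa> v1" "admissible \<kappa> v2" "admissible \<kappa> v3"
    and G: "0 < gram \<kappa> (side \<kappa> \<eta>1 u2 u3) (side \<kappa> \<eta>2 u3 u1) (side \<kappa> \<eta>3 u1 u2)"
  shows "Q \<le> 0"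
    and "Q = 0 \<Longrightarrow> v1 - u1 = v2 - u2 \<and> v2 - u2 = v3 - u3 \<and> (0 < \<kappa> \<longrightarrow> v1 = u1)"
proof -
  define d1 d2 d3 where d: "d1 = v1 - u1" "d2 = v2 - u2" "d3 = v3 - u3"
  define w1 w2 w3 where w: "w1 = (\<lambda>s. u1 + s * d1)" "w2 = (\<lambda>s. u2 + s * d2)" "w3 = (\<lambda>s. u3 + s * d3)"
  define x y z where xyz: "x = (\<lambda>s. side \<kappa> \<eta>1 (w2 s) (w3 s))" "y = (\<lambda>s. side \<kappa> \<eta>2 (w3 s) (w1 s))"
    "z = (\<lambda>s. side \<kappa> \<eta>3 (w1 s) (w2 s))"
  define g where "g s = d1 * ext_angle \<kappa> (x s) (y s) (z s) + d2 * ext_angle \<kappa> (y s) (z s) (x s)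
      + d3 * ext_angle \<kappa> (z s) (x s) (y s)" for s
  define N where "N s = gram \<kappa> (x s) (y s) (z s)" for s
  have adm: "admissible \<kappa> (w1 s)" "admissible \<kappa> (w2 s)" "admissible \<kappa> (w3 s)" if "0 \<le> s" "s \<le> 1" for s
    using admissible_segment[OF k] u v that unfolding w d by auto
  have pos: "0 < x s" "0 < y s" "0 < z s" if "0 \<le> s" "s \<le> 1" for s
    using adm[OF that] \<eta> k unfolding xyz by (auto intro!: side_pos)
  have dw: "(w1 has_real_derivative d1) (at s)" "(w2 has_real_derivative d2) (at s)"
    "(w3 has_real_derivative d3) (at s)" for s
    unfolding w by (auto intro!: derivative_eq_intros)
  define A1 B1 where AB1: "A1 = (\<lambda>s. side_coef \<kappa> \<eta>1 (w2 s) (w3 s))" "B1 = (\<lambda>s. side_coef \<kappa> \<eta>1 (w3 s) (w2 s))"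
  define A2 B2 where AB2: "A2 = (\<lambda>s. side_coef \<kappa> \<eta>2 (w3 s) (w1 s))" "B2 = (\<lambda>s. side_coef \<kappa> \<eta>2 (w1 s) (w3 s))"
  define A3 B3 where AB3: "A3 = (\<lambda>s. side_coef \<kappa> \<eta>3 (w1 s) (w2 s))" "B3 = (\<lambda>s. side_coef \<kappa> \<eta>3 (w2 s) (w1 s))"
  have dx: "(x has_real_derivative A1 s * d2 + B1 s * d3) (at s)"
    and dy: "(y has_real_derivative A2 s * d3 + B2 s * d1) (at s)"
    and dz: "(z has_real_derivative A3 s * d1 + B3 s * d2) (at s)" if "0 \<le> s" "s \<le> 1" for s
    unfolding xyz AB1 AB2 AB3 using adm[OF that] by (auto intro!: side_deriv dw)
  have cx: "continuous_on {0..1} x" and cy: "continuous_on {0..1} y" and cz: "continuous_on {0..1} z"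
    using DERIV_isCont[OF dx] DERIV_isCont[OF dy] DERIV_isCont[OF dz]
    by (simp_all add: continuous_at_imp_continuous_on)
  have cont: "continuous_on {0..1} g"
    unfolding g_def by (intro continuous_intros ext_angle_continuous k cx cy cz) (use pos in auto)
  have der: "\<exists>D. (g has_real_derivative D) (at s) \<and> D \<le> 0 \<and>
      (D = 0 \<longrightarrow> d1 = d2 \<and> d2 = d3 \<and> (0 < \<kappa> \<longrightarrow> d1 = 0))" if s: "0 \<le> s" "s \<le> 1" "0 < N s" for s
  proof -
    define S1 S2 S3 where S: "S1 = geo_sq \<kappa> (x s)" "S2 = geo_sq \<kappa> (y s)" "S3 = geo_sq \<kappa> (z s)"
    have Sp: "0 < S1" "0 < S2" "0 < S3" unfolding S using pos[OF s(1,2)] by (auto intro!: geo_sq_pos k)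
    let ?F = "angle_form \<kappa> (x s) (y s) (z s) (A1 s / S1) (B1 s / S1) (A2 s / S2) (B2 s / S2) (A3 s / S3) (B3 s / S3) d1 d2 d3"
    have G: "0 < gram \<kappa> (x s) (y s) (z s)" "0 < gram \<kappa> (y s) (z s) (x s)" "0 < gram \<kappa> (z s) (x s) (y s)"
      and N: "gram \<kappa> (x s) (y s) (z s) = N s" "gram \<kappa> (y s) (z s) (x s) = N s" "gram \<kappa> (z s) (x s) (y s) = N s"
      using s(3) by (simp_all add: N_def gram_rotate)
    note D1 = ext_angle_deriv[OF k dx[OF s(1,2)] dy[OF s(1,2)] dz[OF s(1,2)] pos(2,3)[OF s(1,2)] G(1)]
    note D2 = ext_angle_deriv[OF k dy[OF s(1,2)] dz[OF s(1,2)] dx[OF s(1,2)] pos(3,1)[OF s(1,2)] G(2)]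
    note D3 = ext_angle_deriv[OF k dz[OF s(1,2)] dx[OF s(1,2)] dy[OF s(1,2)] pos(1,2)[OF s(1,2)] G(3)]
    have "(g has_real_derivative ?F / sqrt (N s)) (at s)"
      unfolding g_def[abs_def]
    proof (rule DERIV_cong[OF DERIV_add[OF DERIV_add[OF DERIV_cmult[OF D1] DERIV_cmult[OF D2]] DERIV_cmult[OF D3]]],
        unfold N S[symmetric])
      have e: "geo_sq \<kappa> (x s) * (A1 s / S1 * d2 + B1 s / S1 * d3) = A1 s * d2 + B1 s * d3"
        "geo_sq \<kappa> (y s) * (A2 s / S2 * d3 + B2 s / S2 * d1) = A2 s * d3 + B2 s * d1"
        "geo_sq \<kappa> (z s) * (A3 s / S3 * d1 + B3 s / S3 * d2) = A3 s * d1 + B3 s * d2"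
        unfolding S[symmetric] using Sp by (auto simp: field_simps)
      have e': "A1 s / S1 * d2 + B1 s / S1 * d3 = (A1 s * d2 + B1 s * d3) / S1"
        "A2 s / S2 * d3 + B2 s / S2 * d1 = (A2 s * d3 + B2 s * d1) / S2"
        "A3 s / S3 * d1 + B3 s / S3 * d2 = (A3 s * d1 + B3 s * d2) / S3"
        by (simp_all add: add_divide_distrib)
      show "d1 * ((A1 s * d2 + B1 s * d3 - cos_num \<kappa> (z s) (x s) (y s) * ((A2 s * d3 + B2 s * d1) / S2)
            - cos_num \<kappa> (y s) (z s) (x s) * ((A3 s * d1 + B3 s * d2) / S3)) / sqrt (N s))
        + d2 * ((A2 s * d3 + B2 s * d1 - cos_num \<kappa> (x s) (y s) (z s) * ((A3 s * d1 + B3 s * d2) / S3)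
            - cos_num \<kappa> (z s) (x s) (y s) * ((A1 s * d2 + B1 s * d3) / S1)) / sqrt (N s))
        + d3 * ((A3 s * d1 + B3 s * d2 - cos_num \<kappa> (y s) (z s) (x s) * ((A1 s * d2 + B1 s * d3) / S1)
            - cos_num \<kappa> (x s) (y s) (z s) * ((A2 s * d3 + B2 s * d1) / S2)) / sqrt (N s))
        = ?F / sqrt (N s)"
        unfolding angle_form_def e unfolding e' by (simp only: times_divide_eq_right add_divide_distrib)
    qed
    moreover have "?F \<le> 0 \<and> (?F = 0 \<longrightarrow> d1 = d2 \<and> d2 = d3 \<and> (0 < \<kappa> \<longrightarrow> d1 = 0))"
    proof (rule angle_form_neg[OF k pos[OF s(1,2)] G(1)])
      show "0 < A1 s / S1" "0 < B1 s / S1" "0 < A2 s / S2" "0 < B2 s / S2" "0 < A3 s / S3" "0 < B3 s / S3"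
        unfolding AB1 AB2 AB3 using Sp \<eta> k adm[OF s(1,2)] by (simp_all add: side_coef_pos)
      show "geo_sq \<kappa> (x s) * (A1 s / S1) = (1 + \<kappa> * rad_cosh \<kappa> (w2 s)) * x s + rad_cosh \<kappa> (w2 s) - rad_cosh \<kappa> (w3 s)"
        "geo_sq \<kappa> (x s) * (B1 s / S1) = (1 + \<kappa> * rad_cosh \<kappa> (w3 s)) * x s + rad_cosh \<kappa> (w3 s) - rad_cosh \<kappa> (w2 s)"
        "geo_sq \<kappa> (y s) * (A2 s / S2) = (1 + \<kappa> * rad_cosh \<kappa> (w3 s)) * y s + rad_cosh \<kappa> (w3 s) - rad_cosh \<kappa> (w1 s)"
        "geo_sq \<kappa> (y s) * (B2 s / S2) = (1 + \<kappa> * rad_cosh \<kappa> (w1 s)) * y s + rad_cosh \<kappa> (w1 s) - rad_cosh \<kappa> (w3 s)"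
        "geo_sq \<kappa> (z s) * (A3 s / S3) = (1 + \<kappa> * rad_cosh \<kappa> (w1 s)) * z s + rad_cosh \<kappa> (w1 s) - rad_cosh \<kappa> (w2 s)"
        "geo_sq \<kappa> (z s) * (B3 s / S3) = (1 + \<kappa> * rad_cosh \<kappa> (w2 s)) * z s + rad_cosh \<kappa> (w2 s) - rad_cosh \<kappa> (w1 s)"
        unfolding S[symmetric] unfolding AB1 AB2 AB3 xyz using Sp
        by (simp_all add: side_coef_def side_commute)
    qed
    moreover have "0 < sqrt (N s)" using s(3) by simp
    ultimately show ?thesis by (intro exI[of _ "?F / sqrt (N s)"]) (auto simp: divide_nonpos_pos)
  qed
  define Y where "Y = (\<lambda>(a, b, c). d1 * a + d2 * b + d3 * c) ` ({0, pi} \<times> {0, pi} \<times> {0, pi})"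
  have Y: "finite Y" by (simp add: Y_def)
  have degenerate: "g s \<in> Y" if s: "0 \<le> s" "s \<le> 1" "\<not> 0 < N s" for s
  proof -
    have "gram \<kappa> (x s) (y s) (z s) \<le> 0" "gram \<kappa> (y s) (z s) (x s) \<le> 0" "gram \<kappa> (z s) (x s) (y s) \<le> 0"
      using s(3) by (simp_all add: N_def gram_rotate)
    then have "ext_angle \<kappa> (x s) (y s) (z s) \<in> {0, pi}" "ext_angle \<kappa> (y s) (z s) (x s) \<in> {0, pi}"
      "ext_angle \<kappa> (z s) (x s) (y s) \<in> {0, pi}"
      using pos[OF s(1,2)] by (intro ext_angle_degenerate k; simp)+
    then show ?thesis unfolding Y_def g_def by (intro image_eqI[where x = "(_, _, _)"]) auto
  qed
  have mono: "g b \<le> g a" if "0 \<le> a" "a \<le> b" "b \<le> 1" for a b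
  proof (rule nonincreasing_off_finite_set[OF that(2) _ Y])
    show "continuous_on {a..b} g" using cont that by (auto intro: continuous_on_subset)
    show "\<exists>D\<le>0. (g has_real_derivative D) (at s)" if "a < s" "s < b" "g s \<notin> Y" for s
      using der[of s] degenerate[of s] that \<open>0 \<le> a\<close> \<open>b \<le> 1\<close> by auto
  qed
  have Q: "Q = g 1 - g 0"
    unfolding Q_def \<theta>1_def \<theta>2_def \<theta>3_def g_def xyz w d by (simp add: algebra_simps)
  show "Q \<le> 0" using mono[of 0 1] Q by simp
  assume Q0: "Q = 0"
  show "v1 - u1 = v2 - u2 \<and> v2 - u2 = v3 - u3 \<and> (0 < \<kappa> \<longrightarrow> v1 = u1)"
  proof (rule ccontr)
    assume "\<not> ?thesis"
    then have nd: "\<not> (d1 = d2 \<and> d2 = d3 \<and> (0 < \<kappa> \<longrightarrow> d1 = 0))" unfolding d by auto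
    have "continuous_on {0..1} N" unfolding N_def gram_def by (intro continuous_intros cx cy cz)
    moreover have N0: "0 < N 0" using G by (simp add: N_def xyz w)
    ultimately obtain e where e: "0 < e" "\<And>s. s \<in> {0..1} \<Longrightarrow> dist s 0 < e \<Longrightarrow> dist (N s) (N 0) < N 0"
      unfolding continuous_on_iff by (metis atLeastAtMost_iff order_refl zero_le_one)
    define b where "b = min 1 (e / 2)"
    have b: "0 < b" "b \<le> 1" "b < e" using e(1) by (auto simp: b_def)
    have "0 < N s" if "0 \<le> s" "s \<le> b" for s
      using e(2)[of s] that b by (auto simp: dist_real_def)
    then have "\<exists>D. (g has_real_derivative D) (at s) \<and> D < 0" if "0 < s" "s < b" for s
      using der[of s] nd that b by fastforce
    moreover have "continuous_on {0..b} g" using cont b by (auto intro: continuous_on_subset)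
    ultimately have "g b < g 0" using b by (intro DERIV_neg_imp_decreasing_open[of 0 b g]) auto
    then show False using mono[of b 1] b Q Q0 by simp
  qed
qed

section \<open>Summation over a closed surface\<close>

lemma corner_rel_sym:
  assumes "closed_triangulated_surface T" shows "sym (corner_rel T)"
  unfolding corner_rel_def
proof (intro sym_rtrancl symI, clarify)
  fix t i and j :: 3
  assume t: "t \<in> triangles T" and ji: "j \<noteq> i"
  have T: "nbr T t i \<in> triangles T" "bij (glue T t i)" "nbr T (nbr T t i) (glue T t i i) = t"
    "glue T (nbr T t i) (glue T t i i) = inv (glue T t i)"
    using assms t by (auto simp: closed_triangulated_surface_def)
  have "glue T t i j \<noteq> glue T t i i" using T(2) ji by (auto dest: bij_is_inj injD)
  moreover have "glue T (nbr T t i) (glue T t i i) (glue T t i j) = j"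
    using T(2,4) by (simp add: bij_is_inj)
  ultimately show "\<exists>t' i' j'. ((nbr T t i, glue T t i j), t, j) = ((t', j'), nbr T t' i', glue T t' i' j')
      \<and> t' \<in> triangles T \<and> j' \<noteq> i'"
    using T by (intro exI[of _ "nbr T t i"] exI[of _ "glue T t i i"] exI[of _ "glue T t i j"]) simp
qed

lemma vertex_eq_iff:
  assumes "closed_triangulated_surface T"
  shows "vertex T c = vertex T c' \<longleftrightarrow> c' \<in> vertex T c"
proof -
  have "equiv UNIV (corner_rel T)"
    using corner_rel_sym[OF assms]
    by (simp add: equiv_def corner_rel_def refl_rtrancl trans_rtrancl)
  then show ?thesis unfolding vertex_def by (auto simp: eq_equiv_class_iff)
qed

lemma vertex_subset:
  assumes "closed_triangulated_surface T" "t \<in> triangles T"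
  shows "vertex T (t, j) \<subseteq> triangles T \<times> UNIV"
proof -
  have "fst c \<in> triangles T" if "((t, j), c) \<in> corner_rel T" for c
    using that unfolding corner_rel_def
    by (induction rule: rtrancl_induct) (use assms in \<open>auto simp: closed_triangulated_surface_def\<close>)
  then show ?thesis by (force simp: vertex_def)
qed

lemma vertices_eq: "vertices T = vertex T ` (triangles T \<times> UNIV)"
  unfolding vertices_def quotient_def vertex_def by blast

lemma vertex_glued:
  assumes "closed_triangulated_surface T" "t \<in> triangles T" "j \<noteq> i"
  shows "vertex T (nbr T t i, glue T t i j) = vertex T (t, j)"
proof -
  have "(nbr T t i, glue T t i j) \<in> vertex T (t, j)"
    unfolding vertex_def corner_rel_def using assms by auto
  then show ?thesis using vertex_eq_iff[OF assms(1)] by blast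
qed

text \<open>The vertices, as sets of corners, partition the corners.\<close>

lemma sum_over_vertices:
  fixes f :: "'f \<times> 3 \<Rightarrow> real"
  assumes "closed_triangulated_surface T"
  shows "(\<Sum>c \<in> triangles T \<times> UNIV. f c * h (vertex T c)) = (\<Sum>v \<in> vertices T. (\<Sum>c \<in> v. f c) * h v)"
proof -
  let ?C = "triangles T \<times> (UNIV :: 3 set)"
  have fin: "finite ?C" using assms by (simp add: closed_triangulated_surface_def)
  have corners: "{c \<in> ?C. vertex T c = v} = v" if "v \<in> vertices T" for v
  proof -
    obtain c where c: "c \<in> ?C" "v = vertex T c" using \<open>v \<in> vertices T\<close> by (auto simp: vertices_eq)
    have "v \<subseteq> ?C" using vertex_subset[OF assms] c by (cases c) auto
    then show ?thesis using vertex_eq_iff[OF assms, of c] c by auto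
  qed
  have "(\<Sum>c \<in> ?C. f c * h (vertex T c)) = (\<Sum>v \<in> vertices T. \<Sum>c \<in> {c \<in> ?C. vertex T c = v}. f c * h (vertex T c))"
    using fin by (intro sum.group[symmetric]) (auto simp: vertices_eq)
  also have "\<dots> = (\<Sum>v \<in> vertices T. \<Sum>c \<in> {c \<in> ?C. vertex T c = v}. f c * h v)"
    by (intro sum.cong) auto
  also have "\<dots> = (\<Sum>v \<in> vertices T. (\<Sum>c \<in> v. f c) * h v)"
    by (intro sum.cong) (simp_all add: corners sum_distrib_right)
  finally show ?thesis .
qed

definition packing_side :: "real \<Rightarrow> 'f gluing \<Rightarrow> (('f \<times> 3) set \<Rightarrow> real) \<Rightarrow> (('f \<times> 3) set \<Rightarrow> real) \<Rightarrow> 'f \<times> 3 \<Rightarrow> real" where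
  "packing_side \<kappa> T I w = (\<lambda>(t, i). side \<kappa> (I (edge T (t, i))) (w (vertex T (t, i + 1))) (w (vertex T (t, i + 2))))"

definition packing_angle :: "real \<Rightarrow> 'f gluing \<Rightarrow> (('f \<times> 3) set \<Rightarrow> real) \<Rightarrow> (('f \<times> 3) set \<Rightarrow> real) \<Rightarrow> 'f \<times> 3 \<Rightarrow> real" where
  "packing_angle \<kappa> T I w = (\<lambda>(t, j). ext_angle \<kappa> (packing_side \<kappa> T I w (t, j))
     (packing_side \<kappa> T I w (t, j + 1)) (packing_side \<kappa> T I w (t, j + 2)))"

lemma label_arith: "(1::3) + 1 = 2" "(1::3) + 2 = 3" "(2::3) + 1 = 3" "(2::3) + 2 = 1" "(3::3) + 1 = 1" "(3::3) + 2 = 2"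
  by simp_all

lemma label_cycle: "(j::3) + 1 + 1 = j + 2" "(j::3) + 1 + 2 = j" "(j::3) + 2 + 1 = j" "(j::3) + 2 + 2 = j + 1" "(j::3) \<noteq> j + 1"
  using exhaust_3[of j] by (auto simp: label_arith)

text \<open>The contributions of the triangles are nonpositive by \<open>triangle_angles_monotone\<close> and add up to zero, because the
  sum over the corners can be rearranged into one over the vertices, where the angle sums agree.
  Hence each of them is zero.\<close>

lemma rigid_on_triangles:
  assumes T: "closed_triangulated_surface T" and I: "\<forall>e \<in> edges T. 0 \<le> I e" and k: "0 \<le> \<kappa>"
    and u: "\<forall>v \<in> vertices T. admissible \<kappa> (u v)" and u': "\<forall>v \<in> vertices T. admissible \<kappa> (u' v)"
    and G: "\<forall>t \<in> triangles T. 0 < gram \<kappa> (packing_side \<kappa> T I u (t, 1)) (packing_side \<kappa> T I u (t, 2)) (packing_side \<kappa> T I u (t, 3))"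
    and eq: "\<forall>v \<in> vertices T. (\<Sum>c \<in> v. packing_angle \<kappa> T I u c) = (\<Sum>c \<in> v. packing_angle \<kappa> T I u' c)"
    and t: "t \<in> triangles T"
  shows "u' (vertex T (t, i)) - u (vertex T (t, i)) = u' (vertex T (t, j)) - u (vertex T (t, j))"
    and "0 < \<kappa> \<Longrightarrow> u' (vertex T (t, i)) = u (vertex T (t, i))"
proof -
  define F where "F t j = (packing_angle \<kappa> T I u' (t, j) - packing_angle \<kappa> T I u (t, j))
      * (u' (vertex T (t, j)) - u (vertex T (t, j)))" for t j
  have fin: "finite (triangles T)" using T by (simp add: closed_triangulated_surface_def)
  have v: "vertex T (t, j) \<in> vertices T" "edge T (t, j) \<in> edges T" if "t \<in> triangles T" for t j
    using that by (auto simp: vertices_eq edges_def)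
  have "(\<Sum>t \<in> triangles T. \<Sum>j \<in> UNIV. F t j) =
     (\<Sum>c \<in> triangles T \<times> UNIV. (packing_angle \<kappa> T I u' c - packing_angle \<kappa> T I u c)
      * (u' (vertex T c) - u (vertex T c)))"
    by (simp add: sum.cartesian_product F_def split_def)
  also have "\<dots> = (\<Sum>v \<in> vertices T. (\<Sum>c \<in> v. packing_angle \<kappa> T I u' c - packing_angle \<kappa> T I u c)
      * (u' v - u v))"
    by (rule sum_over_vertices[OF T, where h = "\<lambda>v. u' v - u v"])
  also have "\<dots> = 0" using eq by (intro sum.neutral) (simp add: sum_subtractf)
  finally have zero: "(\<Sum>t \<in> triangles T. \<Sum>j \<in> UNIV. F t j) = 0" .
  have tri: "(\<Sum>j \<in> UNIV. F t j) \<le> 0"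
    "(\<Sum>j \<in> UNIV. F t j) = 0 \<Longrightarrow> u' (vertex T (t, 1)) - u (vertex T (t, 1)) = u' (vertex T (t, 2)) - u (vertex T (t, 2))
      \<and> u' (vertex T (t, 2)) - u (vertex T (t, 2)) = u' (vertex T (t, 3)) - u (vertex T (t, 3))
      \<and> (0 < \<kappa> \<longrightarrow> u' (vertex T (t, 1)) = u (vertex T (t, 1)))" if t: "t \<in> triangles T" for t
  proof -
    have I: "0 \<le> I (edge T (t, j))" for j using I v(2)[OF t] by blast
    have adm: "admissible \<kappa> (u (vertex T (t, j)))" "admissible \<kappa> (u' (vertex T (t, j)))" for j
      using u u' v(1)[OF t] by blast+
    note m = triangle_angles_monotone[OF k I[of 1] I[of 2] I[of 3] adm(1)[of 1] adm(1)[of 2] adm(1)[of 3]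
       adm(2)[of 1] adm(2)[of 2] adm(2)[of 3]]
    have G': "0 < gram \<kappa> (side \<kappa> (I (edge T (t, 1))) (u (vertex T (t, 2))) (u (vertex T (t, 3))))
       (side \<kappa> (I (edge T (t, 2))) (u (vertex T (t, 3))) (u (vertex T (t, 1))))
       (side \<kappa> (I (edge T (t, 3))) (u (vertex T (t, 1))) (u (vertex T (t, 2))))"
    proof -
      have "0 < gram \<kappa> (packing_side \<kappa> T I u (t, 1)) (packing_side \<kappa> T I u (t, 2)) (packing_side \<kappa> T I u (t, 3))"
        using G t by blast
      then show ?thesis unfolding packing_side_def by (simp only: label_arith prod.case)
    qed
    show "(\<Sum>j \<in> UNIV. F t j) \<le> 0"
      unfolding F_def sum_3 packing_angle_def packing_side_def prod.case label_arith by (rule m(1)[OF G'])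
    show "(\<Sum>j \<in> UNIV. F t j) = 0 \<Longrightarrow> u' (vertex T (t, 1)) - u (vertex T (t, 1)) = u' (vertex T (t, 2)) - u (vertex T (t, 2))
      \<and> u' (vertex T (t, 2)) - u (vertex T (t, 2)) = u' (vertex T (t, 3)) - u (vertex T (t, 3))
      \<and> (0 < \<kappa> \<longrightarrow> u' (vertex T (t, 1)) = u (vertex T (t, 1)))"
      unfolding F_def sum_3 packing_angle_def packing_side_def prod.case label_arith by (rule m(2)[OF G'])
  qed
  have "(\<Sum>t \<in> triangles T. - (\<Sum>j \<in> UNIV. F t j)) = 0" using zero by (simp add: sum_negf)
  then have "(\<Sum>j \<in> UNIV. F t j) = 0"
    using sum_nonneg_eq_0_iff[OF fin, of "\<lambda>t. - (\<Sum>j \<in> UNIV. F t j)"] tri(1) t by auto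
  note c = tri(2)[OF t this]
  show "u' (vertex T (t, i)) - u (vertex T (t, i)) = u' (vertex T (t, j)) - u (vertex T (t, j))"
    using c exhaust_3[of i] exhaust_3[of j] by (elim disjE) auto
  show "u' (vertex T (t, i)) = u (vertex T (t, i))" if "0 < \<kappa>"
    using c that exhaust_3[of i] by (elim disjE) auto
qed

text \<open>Adjacent triangles share the end points of a side, so the constant is passed on across each side.\<close>

lemma rigid_on_surface:
  assumes T: "closed_triangulated_surface T" "connected_surface T"
    and const: "\<And>t i j. t \<in> triangles T \<Longrightarrow> d (vertex T (t, i)) = d (vertex T (t, j))"
  shows "\<exists>\<delta>. \<forall>t \<in> triangles T. \<forall>i. d (vertex T (t, i)) = (\<delta> :: real)"
proof -
  obtain s where s: "s \<in> triangles T" using T(1) by (auto simp: closed_triangulated_surface_def)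
  have step: "d (vertex T (nbr T t i, 1)) = d (vertex T (t, 1))" if t: "t \<in> triangles T" for t i
  proof -
    have "nbr T t i \<in> triangles T" using T(1) t by (simp add: closed_triangulated_surface_def)
    then have "d (vertex T (nbr T t i, 1)) = d (vertex T (nbr T t i, glue T t i (i + 1)))" by (rule const)
    also have "\<dots> = d (vertex T (t, i + 1))"
      using vertex_glued[OF T(1) t] label_cycle(5)[of i] by metis
    finally show ?thesis using const[OF t] by simp
  qed
  have "d (vertex T (t, 1)) = d (vertex T (s, 1))" if "t \<in> triangles T" for t
  proof -
    have "(s, t) \<in> {(t, nbr T t i) | t i. t \<in> triangles T}\<^sup>*"
      using T(2) s that by (simp add: connected_surface_def)
    then show ?thesis by (induction rule: rtrancl_induct) (use step in auto)
  qed
  then have "d (vertex T (t, i)) = d (vertex T (s, 1))" if "t \<in> triangles T" for t i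
    using const[OF that, of i 1] that by simp
  then show ?thesis by blast
qed

section \<open>Euclidean and hyperbolic metrics as packings\<close>

lemma clamped_angle:
  assumes "0 \<le> \<kappa>" "0 < y" "0 < z"
    and "cos_num \<kappa> x y z / sqrt (geo_sq \<kappa> y * geo_sq \<kappa> z) = c" "\<bar>c\<bar> < 1"
  shows "ext_angle \<kappa> x y z = arccos c" "0 < gram \<kappa> x y z"
proof -
  show "ext_angle \<kappa> x y z = arccos c"
    unfolding ext_angle_def assms(4) using assms(5) by (auto simp: max_def min_def)
  show "0 < gram \<kappa> x y z"
    unfolding nondegenerate_iff[OF assms(1-3)] assms(4) by (rule assms(5))
qed

lemma eucl_inner_angle_ext:
  assumes "a < b + c" "b < c + a" "c < a + b"
  shows "eucl_inner_angle a b c = ext_angle 0 (a\<^sup>2 / 2) (b\<^sup>2 / 2) (c\<^sup>2 / 2)"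
    and "0 < gram 0 (a\<^sup>2 / 2) (b\<^sup>2 / 2) (c\<^sup>2 / 2)"
proof -
  have pos: "a > 0" "b > 0" "c > 0" using assms by auto
  let ?c = "(b\<^sup>2 + c\<^sup>2 - a\<^sup>2) / (2 * b * c)"
  have "sqrt (b\<^sup>2 * c\<^sup>2) = b * c" using pos by (simp add: real_sqrt_mult)
  then have *: "cos_num 0 (a\<^sup>2 / 2) (b\<^sup>2 / 2) (c\<^sup>2 / 2) / sqrt (geo_sq 0 (b\<^sup>2 / 2) * geo_sq 0 (c\<^sup>2 / 2)) = ?c"
    using pos by (simp add: cos_num_def geo_sq_def field_simps)
  have "\<bar>b - c\<bar> < \<bar>a\<bar>" using assms by auto
  then have "(b - c)\<^sup>2 < a\<^sup>2" using abs_le_square_iff[of a "b - c"] by (simp add: not_le[symmetric])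
  moreover have "\<bar>a\<bar> < \<bar>b + c\<bar>" using assms pos by auto
  then have "a\<^sup>2 < (b + c)\<^sup>2" using abs_le_square_iff[of "b + c" a] by (simp add: not_le[symmetric])
  ultimately have "b\<^sup>2 + c\<^sup>2 - a\<^sup>2 < 2 * b * c" "- (2 * b * c) < b\<^sup>2 + c\<^sup>2 - a\<^sup>2"
    by (simp_all add: power2_sum power2_diff)
  then have lt: "\<bar>?c\<bar> < 1" using pos by (auto simp: abs_less_iff field_simps)
  show "eucl_inner_angle a b c = ext_angle 0 (a\<^sup>2 / 2) (b\<^sup>2 / 2) (c\<^sup>2 / 2)"
    "0 < gram 0 (a\<^sup>2 / 2) (b\<^sup>2 / 2) (c\<^sup>2 / 2)"
    using clamped_angle[OF _ _ _ * lt] pos eucl_inner_angle_eq[OF assms] by auto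
qed

lemma hyp_inner_angle_ext:
  assumes "a < b + c" "b < c + a" "c < a + b"
  shows "hyp_inner_angle a b c = ext_angle 1 (cosh a - 1) (cosh b - 1) (cosh c - 1)"
    and "0 < gram 1 (cosh a - 1) (cosh b - 1) (cosh c - 1)"
proof -
  have pos: "a > 0" "b > 0" "c > 0" using assms by auto
  let ?c = "(cosh b * cosh c - cosh a) / (sinh b * sinh c)"
  have sh: "sinh b > 0" "sinh c > 0" using pos by auto
  have ch: "cosh b > 1" "cosh c > 1"
    using cosh_real_nonneg_less_iff[of 0 b] cosh_real_nonneg_less_iff[of 0 c] pos by auto
  have g: "geo_sq 1 (cosh x - 1) = (sinh x)\<^sup>2" for x :: real
    using cosh_square_eq[of x] unfolding geo_sq_def by algebra
  have "sqrt ((sinh b)\<^sup>2 * (sinh c)\<^sup>2) = sinh b * sinh c" using sh by (simp add: real_sqrt_mult)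
  then have *: "cos_num 1 (cosh a - 1) (cosh b - 1) (cosh c - 1)
      / sqrt (geo_sq 1 (cosh b - 1) * geo_sq 1 (cosh c - 1)) = ?c"
    unfolding g by (simp add: cos_num_def algebra_simps)
  have "cosh (b - c) < cosh a"
    using cosh_real_nonneg_less_iff[of "\<bar>b - c\<bar>" a] assms pos by (simp add: abs_less_iff)
  moreover have "cosh a < cosh (b + c)"
    using cosh_real_nonneg_less_iff[of a "b + c"] assms pos by simp
  ultimately have lt: "\<bar>?c\<bar> < 1"
    using sh by (auto simp: abs_less_iff field_simps cosh_add cosh_diff)
  show "hyp_inner_angle a b c = ext_angle 1 (cosh a - 1) (cosh b - 1) (cosh c - 1)"
    "0 < gram 1 (cosh a - 1) (cosh b - 1) (cosh c - 1)"
    using clamped_angle[OF _ _ _ * lt] ch hyp_inner_angle_eq[OF assms] by auto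
qed

lemma eucl_length_side:
  assumes "0 < r" "0 < s" "0 \<le> \<eta>"
  shows "(eucl_length \<eta> r s)\<^sup>2 / 2 = side 0 \<eta> (ln (r / 2)) (ln (s / 2))"
  using assms by (simp add: eucl_length_def side_def rad_cosh_def rad_sinh_def field_simps power2_eq_square)

lemma rad_tanh:
  fixes r :: real assumes "0 < r"
  shows "admissible 1 (ln (tanh (r / 2)))" "rad_cosh 1 (ln (tanh (r / 2))) = cosh r - 1"
    "rad_sinh 1 (ln (tanh (r / 2))) = sinh r"
proof -
  define S C where SC: "S = sinh (r / 2)" "C = cosh (r / 2)"
  have C: "0 < C" by (simp add: SC)
  have CS: "C\<^sup>2 = S\<^sup>2 + 1" by (simp add: SC cosh_square_eq)
  have e: "exp (ln (tanh (r / 2))) = S / C" using assms by (simp add: SC tanh_def)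
  have "1 - (S / C)\<^sup>2 = (C\<^sup>2 - S\<^sup>2) / C\<^sup>2" using C by (simp add: power_divide diff_divide_distrib)
  then have D: "1 - (S / C)\<^sup>2 = 1 / C\<^sup>2" by (simp add: CS)
  have r: "r = 2 * (r / 2)" by simp
  have sr: "sinh r = 2 * S * C" by (subst r) (simp only: sinh_double SC)
  have cr: "cosh r = C\<^sup>2 + S\<^sup>2" by (subst r) (simp only: cosh_double SC)
  have "0 < 1 - (S / C)\<^sup>2" unfolding D using C by simp
  then show "admissible 1 (ln (tanh (r / 2)))" unfolding admissible_def e by simp
  show "rad_cosh 1 (ln (tanh (r / 2))) = cosh r - 1"
  proof -
    have "rad_cosh 1 (ln (tanh (r / 2))) = 2 * S\<^sup>2"
      unfolding rad_cosh_def e mult_1 D using C by (simp add: power_divide)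
    then show ?thesis using cr CS by simp
  qed
  show "rad_sinh 1 (ln (tanh (r / 2))) = sinh r"
    unfolding rad_sinh_def e sr using D C by (simp add: power2_eq_square)
qed

lemma hyp_length_side:
  assumes "0 < r" "0 < s" "0 \<le> \<eta>"
  shows "cosh (hyp_length \<eta> r s) - 1 = side 1 \<eta> (ln (tanh (r / 2))) (ln (tanh (s / 2)))"
proof -
  have "1 * 1 \<le> cosh r * cosh s" by (intro mult_mono cosh_real_ge_1) auto
  moreover have "0 \<le> \<eta> * sinh r * sinh s" using assms by simp
  ultimately show ?thesis
    unfolding hyp_length_def side_def rad_tanh(2,3)[OF assms(1)] rad_tanh(2,3)[OF assms(2)]
    by (simp add: cosh_arcosh_real algebra_simps)
qed

lemma polyhedral_triangle:
  assumes "polyhedral_metric T l" "t \<in> triangles T"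
  shows "l (edge T (t, j)) < l (edge T (t, j + 1)) + l (edge T (t, j + 2))"
    "l (edge T (t, j + 1)) < l (edge T (t, j + 2)) + l (edge T (t, j))"
    "l (edge T (t, j + 2)) < l (edge T (t, j)) + l (edge T (t, j + 1))"
proof -
  have "l (edge T (t, i)) < l (edge T (t, i + 1)) + l (edge T (t, i + 2))" for i
    using assms by (simp add: polyhedral_metric_def)
  from this[of j] this[of "j + 1"] this[of "j + 2"]
  show "l (edge T (t, j)) < l (edge T (t, j + 1)) + l (edge T (t, j + 2))"
    "l (edge T (t, j + 1)) < l (edge T (t, j + 2)) + l (edge T (t, j))"
    "l (edge T (t, j + 2)) < l (edge T (t, j)) + l (edge T (t, j + 1))"
    unfolding label_cycle .
qed

lemma eucl_metric_as_packing:
  assumes T: "closed_triangulated_surface T" and I: "\<forall>e \<in> edges T. 0 \<le> I e"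
    and l: "eucl_inversive_metric T I l"
  obtains u where "\<forall>v \<in> vertices T. admissible 0 (u v)"
    "\<forall>t \<in> triangles T. \<forall>i. (l (edge T (t, i)))\<^sup>2 / 2 = packing_side 0 T I u (t, i)"
    "\<forall>t \<in> triangles T. 0 < gram 0 (packing_side 0 T I u (t, 1)) (packing_side 0 T I u (t, 2)) (packing_side 0 T I u (t, 3))"
    "\<forall>v \<in> vertices T. eucl_curvature T l v = 2 * pi - (\<Sum>c \<in> v. packing_angle 0 T I u c)"
proof -
  obtain r where r: "\<forall>v \<in> vertices T. 0 < r v"
    "\<forall>t \<in> triangles T. \<forall>i. l (edge T (t, i)) =
       eucl_length (I (edge T (t, i))) (r (vertex T (t, i + 1))) (r (vertex T (t, i + 2)))"
    and poly: "polyhedral_metric T l"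
    using l by (auto simp: eucl_inversive_metric_def)
  define u where "u v = ln (r v / 2)" for v
  have side: "(l (edge T (t, i)))\<^sup>2 / 2 = packing_side 0 T I u (t, i)" if "t \<in> triangles T" for t i
  proof -
    have "0 < r (vertex T (t, j))" "0 \<le> I (edge T (t, i))" for j
      using r(1) I that by (auto simp: vertices_eq edges_def)
    then show ?thesis using r(2) that by (simp add: packing_side_def u_def eucl_length_side)
  qed
  note tri = polyhedral_triangle[OF poly]
  show ?thesis
  proof
    show "\<forall>v \<in> vertices T. admissible 0 (u v)" by (simp add: admissible_def)
    show "\<forall>t \<in> triangles T. 0 < gram 0 (packing_side 0 T I u (t, 1)) (packing_side 0 T I u (t, 2)) (packing_side 0 T I u (t, 3))"
      using eucl_inner_angle_ext(2)[OF tri, of _ 1] by (simp add: side label_arith)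
    show "\<forall>v \<in> vertices T. eucl_curvature T l v = 2 * pi - (\<Sum>c \<in> v. packing_angle 0 T I u c)"
    proof
      fix v assume that: "v \<in> vertices T"
      have "v \<subseteq> triangles T \<times> UNIV" using that vertex_subset[OF T] by (auto simp: vertices_eq)
      then have "(\<Sum>(t, j) \<in> v. eucl_inner_angle (l (edge T (t, j))) (l (edge T (t, j + 1))) (l (edge T (t, j + 2))))
          = (\<Sum>c \<in> v. packing_angle 0 T I u c)"
        by (intro sum.cong) (auto simp: packing_angle_def side[symmetric] eucl_inner_angle_ext(1)[OF tri])
      then show "eucl_curvature T l v = 2 * pi - (\<Sum>c \<in> v. packing_angle 0 T I u c)" by (simp add: eucl_curvature_def)
    qed
  qed (use side in blast)
qed

lemma hyp_metric_as_packing: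
  assumes T: "closed_triangulated_surface T" and I: "\<forall>e \<in> edges T. 0 \<le> I e"
    and l: "hyp_inversive_metric T I l"
  obtains u where "\<forall>v \<in> vertices T. admissible 1 (u v)"
    "\<forall>t \<in> triangles T. \<forall>i. cosh (l (edge T (t, i))) - 1 = packing_side 1 T I u (t, i)"
    "\<forall>t \<in> triangles T. 0 < gram 1 (packing_side 1 T I u (t, 1)) (packing_side 1 T I u (t, 2)) (packing_side 1 T I u (t, 3))"
    "\<forall>v \<in> vertices T. hyp_curvature T l v = 2 * pi - (\<Sum>c \<in> v. packing_angle 1 T I u c)"
proof -
  obtain r where r: "\<forall>v \<in> vertices T. 0 < r v"
    "\<forall>t \<in> triangles T. \<forall>i. l (edge T (t, i)) =
       hyp_length (I (edge T (t, i))) (r (vertex T (t, i + 1))) (r (vertex T (t, i + 2)))"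
    and poly: "polyhedral_metric T l"
    using l by (auto simp: hyp_inversive_metric_def)
  define u where "u v = ln (tanh (r v / 2))" for v
  have side: "cosh (l (edge T (t, i))) - 1 = packing_side 1 T I u (t, i)" if "t \<in> triangles T" for t i
  proof -
    have "0 < r (vertex T (t, j))" "0 \<le> I (edge T (t, i))" for j
      using r(1) I that by (auto simp: vertices_eq edges_def)
    then show ?thesis using r(2) that by (simp add: packing_side_def u_def hyp_length_side)
  qed
  note tri = polyhedral_triangle[OF poly]
  show ?thesis
  proof
    show "\<forall>v \<in> vertices T. admissible 1 (u v)" using r(1) by (simp add: u_def rad_tanh(1))
    show "\<forall>t \<in> triangles T. 0 < gram 1 (packing_side 1 T I u (t, 1)) (packing_side 1 T I u (t, 2)) (packing_side 1 T I u (t, 3))"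
      using hyp_inner_angle_ext(2)[OF tri, of _ 1] by (simp add: side label_arith)
    show "\<forall>v \<in> vertices T. hyp_curvature T l v = 2 * pi - (\<Sum>c \<in> v. packing_angle 1 T I u c)"
    proof
      fix v assume that: "v \<in> vertices T"
      have "v \<subseteq> triangles T \<times> UNIV" using that vertex_subset[OF T] by (auto simp: vertices_eq)
      then have "(\<Sum>(t, j) \<in> v. hyp_inner_angle (l (edge T (t, j))) (l (edge T (t, j + 1))) (l (edge T (t, j + 2))))
          = (\<Sum>c \<in> v. packing_angle 1 T I u c)"
        by (intro sum.cong) (auto simp: packing_angle_def side[symmetric] hyp_inner_angle_ext(1)[OF tri])
      then show "hyp_curvature T l v = 2 * pi - (\<Sum>c \<in> v. packing_angle 1 T I u c)" by (simp add: hyp_curvature_def)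
    qed
  qed (use side in blast)
qed

section \<open>Rigidity\<close>

lemma side_scale: "side 0 \<eta> (u + \<delta>) (v + \<delta>) = (exp \<delta>)\<^sup>2 * side 0 \<eta> u v"
  by (simp add: side_def rad_cosh_def rad_sinh_def exp_add power2_eq_square algebra_simps)

lemma hyp_rigidity:
  assumes T: "closed_triangulated_surface T" and I: "\<forall>e \<in> edges T. 0 \<le> I e"
    and l: "hyp_inversive_metric T I l" and l': "hyp_inversive_metric T I l'"
    and eq: "\<forall>v \<in> vertices T. hyp_curvature T l v = hyp_curvature T l' v"
    and e: "e \<in> edges T"
  shows "l e = l' e"
proof -
  obtain u where u: "\<forall>v \<in> vertices T. admissible 1 (u v)"
    "\<forall>t \<in> triangles T. \<forall>i. cosh (l (edge T (t, i))) - 1 = packing_side 1 T I u (t, i)"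
    "\<forall>t \<in> triangles T. 0 < gram 1 (packing_side 1 T I u (t, 1)) (packing_side 1 T I u (t, 2)) (packing_side 1 T I u (t, 3))"
    "\<forall>v \<in> vertices T. hyp_curvature T l v = 2 * pi - (\<Sum>c \<in> v. packing_angle 1 T I u c)"
    by (rule hyp_metric_as_packing[OF T I l]) (rule that)
  obtain u' where u': "\<forall>v \<in> vertices T. admissible 1 (u' v)"
    "\<forall>t \<in> triangles T. \<forall>i. cosh (l' (edge T (t, i))) - 1 = packing_side 1 T I u' (t, i)"
    "\<forall>t \<in> triangles T. 0 < gram 1 (packing_side 1 T I u' (t, 1)) (packing_side 1 T I u' (t, 2)) (packing_side 1 T I u' (t, 3))"
    "\<forall>v \<in> vertices T. hyp_curvature T l' v = 2 * pi - (\<Sum>c \<in> v. packing_angle 1 T I u' c)"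
    by (rule hyp_metric_as_packing[OF T I l']) (rule that)
  have "\<forall>v \<in> vertices T. (\<Sum>c \<in> v. packing_angle 1 T I u c) = (\<Sum>c \<in> v. packing_angle 1 T I u' c)"
    using eq u(4) u'(4) by auto
  note same = rigid_on_triangles(2)[OF T I zero_le_one u(1) u'(1) u(3) this _ zero_less_one]
  obtain t i where ti: "t \<in> triangles T" "e = edge T (t, i)" using e by (auto simp: edges_def)
  have "cosh (l e) - 1 = cosh (l' e) - 1"
    unfolding ti u(2)[rule_format, OF ti(1)] u'(2)[rule_format, OF ti(1)] by (simp add: packing_side_def same ti(1))
  moreover have "0 < l e" "0 < l' e"
    using l l' e by (auto simp: hyp_inversive_metric_def polyhedral_metric_def)
  ultimately show ?thesis
    using arcosh_cosh_real[of "l e"] arcosh_cosh_real[of "l' e"] by simp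
qed

lemma eucl_rigidity:
  assumes T: "closed_triangulated_surface T" "connected_surface T" and I: "\<forall>e \<in> edges T. 0 \<le> I e"
    and l: "eucl_inversive_metric T I l" and l': "eucl_inversive_metric T I l'"
    and eq: "\<forall>v \<in> vertices T. eucl_curvature T l v = eucl_curvature T l' v"
  shows "\<exists>c > 0. \<forall>e \<in> edges T. l' e = c * l e"
proof -
  obtain u where u: "\<forall>v \<in> vertices T. admissible 0 (u v)"
    "\<forall>t \<in> triangles T. \<forall>i. (l (edge T (t, i)))\<^sup>2 / 2 = packing_side 0 T I u (t, i)"
    "\<forall>t \<in> triangles T. 0 < gram 0 (packing_side 0 T I u (t, 1)) (packing_side 0 T I u (t, 2)) (packing_side 0 T I u (t, 3))"
    "\<forall>v \<in> vertices T. eucl_curvature T l v = 2 * pi - (\<Sum>c \<in> v. packing_angle 0 T I u c)"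
    by (rule eucl_metric_as_packing[OF T(1) I l]) (rule that)
  obtain u' where u': "\<forall>v \<in> vertices T. admissible 0 (u' v)"
    "\<forall>t \<in> triangles T. \<forall>i. (l' (edge T (t, i)))\<^sup>2 / 2 = packing_side 0 T I u' (t, i)"
    "\<forall>t \<in> triangles T. 0 < gram 0 (packing_side 0 T I u' (t, 1)) (packing_side 0 T I u' (t, 2)) (packing_side 0 T I u' (t, 3))"
    "\<forall>v \<in> vertices T. eucl_curvature T l' v = 2 * pi - (\<Sum>c \<in> v. packing_angle 0 T I u' c)"
    by (rule eucl_metric_as_packing[OF T(1) I l']) (rule that)
  have "\<forall>v \<in> vertices T. (\<Sum>c \<in> v. packing_angle 0 T I u c) = (\<Sum>c \<in> v. packing_angle 0 T I u' c)"
    using eq u(4) u'(4) by auto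
  note const = rigid_on_triangles(1)[OF T(1) I order_refl u(1) u'(1) u(3) this]
  obtain \<delta> where \<delta>: "\<forall>t \<in> triangles T. \<forall>i. u' (vertex T (t, i)) - u (vertex T (t, i)) = \<delta>"
    using rigid_on_surface[OF T, of "\<lambda>v. u' v - u v", OF const] by blast
  then have shift: "u' (vertex T (t, i)) = u (vertex T (t, i)) + \<delta>" if "t \<in> triangles T" for t i
    using that by (simp add: diff_eq_eq add.commute)
  have "l' e = exp \<delta> * l e" if e: "e \<in> edges T" for e
  proof -
    obtain t i where ti: "t \<in> triangles T" "e = edge T (t, i)" using e by (auto simp: edges_def)
    have "(l' e)\<^sup>2 / 2 = (exp \<delta>)\<^sup>2 * ((l e)\<^sup>2 / 2)"
      unfolding ti u(2)[rule_format, OF ti(1)] u'(2)[rule_format, OF ti(1)] by (simp add: packing_side_def shift ti(1) side_scale)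
    then have "(l' e)\<^sup>2 = (exp \<delta> * l e)\<^sup>2" by (simp add: power_mult_distrib)
    moreover have "0 < l e" "0 < l' e"
      using l l' e by (auto simp: eucl_inversive_metric_def polyhedral_metric_def)
    ultimately show ?thesis by (simp add: power2_eq_iff_nonneg)
  qed
  then show ?thesis by (intro exI[of _ "exp \<delta>"]) simp
qed

theorem theorem1p4:
  fixes T :: "'f gluing" and I :: "('f \<times> 3) set \<Rightarrow> real"
  assumes "closed_triangulated_surface T"
    and "connected_surface T"
    and "\<forall>e \<in> edges T. 0 \<le> I e"
  shows "(\<forall>l l'. hyp_inversive_metric T I l \<and> hyp_inversive_metric T I l' \<and>
            (\<forall>v \<in> vertices T. hyp_curvature T l v = hyp_curvature T l' v) \<longrightarrow>
            (\<forall>e \<in> edges T. l e = l' e)) \<and>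
         (\<forall>l l'. eucl_inversive_metric T I l \<and> eucl_inversive_metric T I l' \<and>
            (\<forall>v \<in> vertices T. eucl_curvature T l v = eucl_curvature T l' v) \<longrightarrow>
            (\<exists>c > 0. \<forall>e \<in> edges T. l' e = c * l e))"
  using hyp_rigidity[OF assms(1,3)] eucl_rigidity[OF assms] by blast

end
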